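(* Let $A$ be a prime Goldie $\mathsf{k}$-algebra and $G$ a finite group of automorphisms of $A$. Suppose that either the trace of $G$ on $A$ is nondegenerate, or $A$ has no nonzero nilpotent elements. Suppose also that $B=A^G$ is a prime Goldie ring. Then $LD\,A=LD\,B$, and if $A$ is $LD$-stable then so is $B$.
   Context: $\mathsf{k}$ is a field of characteristic zero. $A^G=\{a\in A: g(a)=a\ \forall g\in G\}$. The trace is $\operatorname{tr}(a)=\sum_{g\in G}g(a)$; it is nondegenerate if $\operatorname{tr}(aA)\neq0$ for every nonzero $a\in A$. $GK$ is Gelfand–Kirillov dimension: $GK\,R=\sup_V\limsup_m\log(\dim V^m)/\log m$ over subframes $V$ (finite-dimensional subspaces containing $1$). Lower transcendence degree $LD$: if every subframe $V$ admits a finite-dimensional nonzero $W$ with $\dim VW=\dim W$, then $LD\,R=0$; otherwise $LD\,R=\sup_V\sup\{d>0:\exists c>0,\ \dim VW\ge\dim W+c(\dim W)^{(d-1)/d}\text{ for all finite-dimensional }W\neq0\}$. $R$ is $LD$-stable if $LD\,R=GK\,R$. *)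

theory Defs
  imports Complex_Main "HOL-Library.Extended_Real" "HOL-Library.Liminf_Limsup"
begin

definition kalgebra :: "('k::field_char_0 \<Rightarrow> 'a::ring_1 \<Rightarrow> 'a) \<Rightarrow> bool" where
  "kalgebra scale \<longleftrightarrow> vector_space scale \<and>
     (\<forall>c a b. scale c (a * b) = scale c a * b) \<and>
     (\<forall>c a b. scale c (a * b) = a * scale c b)"

definition kalg_aut :: "('k::field_char_0 \<Rightarrow> 'a::ring_1 \<Rightarrow> 'a) \<Rightarrow> ('a \<Rightarrow> 'a) \<Rightarrow> bool" where
  "kalg_aut scale g \<longleftrightarrow> bij g \<and> g 1 = 1 \<and>
     (\<forall>a b. g (a + b) = g a + g b) \<and> (\<forall>a b. g (a * b) = g a * g b) \<and>
     (\<forall>c a. g (scale c a) = scale c (g a))"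

definition finite_aut_group :: "('k::field_char_0 \<Rightarrow> 'a::ring_1 \<Rightarrow> 'a) \<Rightarrow> ('a \<Rightarrow> 'a) set \<Rightarrow> bool" where
  "finite_aut_group scale G \<longleftrightarrow> finite G \<and> id \<in> G \<and>
     (\<forall>g\<in>G. kalg_aut scale g) \<and>
     (\<forall>g\<in>G. \<forall>h\<in>G. g \<circ> h \<in> G) \<and> (\<forall>g\<in>G. inv g \<in> G)"

definition fixed_ring :: "('a \<Rightarrow> 'a) set \<Rightarrow> 'a set" where
  "fixed_ring G = {a. \<forall>g\<in>G. g a = a}"

definition trace :: "('a::ring_1 \<Rightarrow> 'a) set \<Rightarrow> 'a \<Rightarrow> 'a" where
  "trace G a = (\<Sum>g\<in>G. g a)"

definition trace_nondegenerate :: "('a::ring_1 \<Rightarrow> 'a) set \<Rightarrow> bool" where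
  "trace_nondegenerate G \<longleftrightarrow> (\<forall>a::'a. a \<noteq> 0 \<longrightarrow> (\<exists>b. trace G (a * b) \<noteq> 0))"

definition no_nilpotents :: "'a::ring_1 itself \<Rightarrow> bool" where
  "no_nilpotents _ \<longleftrightarrow> (\<forall>a::'a. \<forall>n::nat. a ^ n = 0 \<longrightarrow> a = 0)"

text \<open>Ring-theoretic notions for the (unital) subring with carrier S of a ring.\<close>
definition prime_on :: "'a::ring_1 set \<Rightarrow> bool" where
  "prime_on S \<longleftrightarrow> (1::'a) \<noteq> 0 \<and>
     (\<forall>a\<in>S. \<forall>b\<in>S. (\<forall>r\<in>S. a * r * b = 0) \<longrightarrow> a = 0 \<or> b = 0)"

definition right_ideal_on :: "'a::ring_1 set \<Rightarrow> 'a set \<Rightarrow> bool" where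
  "right_ideal_on S I \<longleftrightarrow> I \<subseteq> S \<and> 0 \<in> I \<and>
     (\<forall>x\<in>I. \<forall>y\<in>I. x + y \<in> I) \<and> (\<forall>x\<in>I. - x \<in> I) \<and> (\<forall>x\<in>I. \<forall>r\<in>S. x * r \<in> I)"

definition right_ann_on :: "'a::ring_1 set \<Rightarrow> 'a set \<Rightarrow> 'a set" where
  "right_ann_on S X = {r\<in>S. \<forall>x\<in>X. x * r = 0}"

definition finsum_sets :: "(nat \<Rightarrow> 'a::ring_1 set) \<Rightarrow> nat \<Rightarrow> 'a set" where
  "finsum_sets I n = {(\<Sum>m<n. x m) | x. \<forall>m<n. x m \<in> I m}"

definition goldie_on :: "'a::ring_1 set \<Rightarrow> bool" where
  "goldie_on S \<longleftrightarrow>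
     (\<not> (\<exists>X :: nat \<Rightarrow> 'a set. (\<forall>n. X n \<subseteq> S) \<and>
          (\<forall>n. right_ann_on S (X n) \<subset> right_ann_on S (X (Suc n))))) \<and>
     (\<not> (\<exists>I :: nat \<Rightarrow> 'a set. (\<forall>n. right_ideal_on S (I n) \<and> I n \<noteq> {0}) \<and>
          (\<forall>n. I n \<inter> finsum_sets I n = {0})))"

definition fd_subspace :: "('k::field_char_0 \<Rightarrow> 'a::ring_1 \<Rightarrow> 'a) \<Rightarrow> 'a set \<Rightarrow> 'a set \<Rightarrow> bool" where
  "fd_subspace scale S W \<longleftrightarrow> W \<subseteq> S \<and> module.subspace scale W \<and>
     (\<exists>F. finite F \<and> module.span scale F = W)"

definition subframe :: "('k::field_char_0 \<Rightarrow> 'a::ring_1 \<Rightarrow> 'a) \<Rightarrow> 'a set \<Rightarrow> 'a set \<Rightarrow> bool" where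
  "subframe scale S V \<longleftrightarrow> fd_subspace scale S V \<and> 1 \<in> V"

definition mult_space :: "('k::field_char_0 \<Rightarrow> 'a::ring_1 \<Rightarrow> 'a) \<Rightarrow> 'a set \<Rightarrow> 'a set \<Rightarrow> 'a set" where
  "mult_space scale V W = module.span scale {v * w | v w. v \<in> V \<and> w \<in> W}"

primrec power_space :: "('k::field_char_0 \<Rightarrow> 'a::ring_1 \<Rightarrow> 'a) \<Rightarrow> 'a set \<Rightarrow> nat \<Rightarrow> 'a set" where
  "power_space scale V 0 = module.span scale {1}"
| "power_space scale V (Suc m) = mult_space scale (power_space scale V m) V"

definition GK_dim :: "('k::field_char_0 \<Rightarrow> 'a::ring_1 \<Rightarrow> 'a) \<Rightarrow> 'a set \<Rightarrow> ereal" where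
  "GK_dim scale S = (SUP V\<in>{V. subframe scale S V}.
      limsup (\<lambda>m. ereal (ln (real (vector_space.dim scale (power_space scale V m))) / ln (real m))))"

definition LD :: "('k::field_char_0 \<Rightarrow> 'a::ring_1 \<Rightarrow> 'a) \<Rightarrow> 'a set \<Rightarrow> ereal" where
  "LD scale S =
     (if \<forall>V. subframe scale S V \<longrightarrow>
            (\<exists>W. fd_subspace scale S W \<and> W \<noteq> {0} \<and>
                 vector_space.dim scale (mult_space scale V W) = vector_space.dim scale W)
      then 0
      else (SUP V\<in>{V. subframe scale S V}.
              SUP d\<in>{d::real. d > 0 \<and> (\<exists>c::real. c > 0 \<and>
                  (\<forall>W. fd_subspace scale S W \<and> W \<noteq> {0} \<longrightarrow>
                     real (vector_space.dim scale (mult_space scale V W)) \<ge>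
                     real (vector_space.dim scale W) +
                       c * real (vector_space.dim scale W) powr ((d - 1) / d)))}.
                ereal d))"

definition LD_stable :: "('k::field_char_0 \<Rightarrow> 'a::ring_1 \<Rightarrow> 'a) \<Rightarrow> 'a set \<Rightarrow> bool" where
  "LD_stable scale S \<longleftrightarrow> LD scale S = GK_dim scale S"

end

theory Submission
  imports Defs
begin

text \<open>
  For a subframe \<open>V\<close> of \<open>B\<close>, the left \<open>B\<close>-linear maps \<open>a \<mapsto> tr (a x)\<close> separate the points of \<open>A\<close>, so that
  a finite-dimensional \<open>W \<subseteq> A\<close> is filtered by pieces isomorphic to subspaces of \<open>B\<close>; since
  \<open>t \<mapsto> t\<^bsup>(d-1)/d\<^esup>\<close> is subadditive, the growth inequality for \<open>V\<close> passes from \<open>B\<close> to \<open>A\<close>, with no bound on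
  the number of pieces needed. In the reduced case \<open>A\<close> is a right Ore domain, and Gaussian elimination
  shows that the trace is nondegenerate.

  Conversely, let \<open>U\<close> be a uniform right ideal of \<open>B\<close>. A Maschke argument shows that \<open>A\<close> is nonsingular over
  \<open>B\<close>, so that every \<open>a \<in> A\<close> is zero or injective on \<open>U\<close>, and an embedding into \<open>A\<^sup>G\<close> shows that \<open>A\<close> contains
  an essential \<open>B\<close>-submodule \<open>x\<^sub>0 U \<oplus> \<dots> \<oplus> x\<^sub>l\<^sub>-\<^sub>1 U\<close>. Up to a denominator \<open>s \<in> U\<close>, a subframe of \<open>A\<close> acts on it
  by matrices over a finite-dimensional \<open>K \<subseteq> U\<close>, which gives the growth inequality for \<open>K\<close> acting on
  subspaces of \<open>U\<close>. Finally a subspace of \<open>B\<close> is cut into slices \<open>u\<^sub>i W \<subseteq> U\<close>.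

  Stability follows from \<open>LD A = LD B \<le> GK B \<le> GK A\<close>.
\<close>

section \<open>Finite-dimensional subspaces of an algebra\<close>

text \<open>Both inequalities between the degrees are instances of one transfer principle: an
  inequality for some subframe of one ring yields one for some subframe of the other, with the same
  \<open>d\<close>. Only \<open>c\<close> may change, since \<open>LD\<close> records
  \<open>d\<close> alone. The case \<open>LD = 0\<close> needs no separate argument, because outside
  it the inequality holds with \<open>d = c = 1\<close>.

  What shapes the bound of \<open>LD\<close> of the algebra by that of the fixed ring is that
  multiplication by a zero divisor can lower dimensions. No quotient ring is formed; the estimates
  are carried out inside \<open>U\<close>, where one nonzero element \<open>u0\<close> tests whether
  a multiplication is injective, and primeness of the fixed ring produces multipliers that pass the
  test.

  The Goldie condition on the algebra concerns its right ideals, whereas the \<open>x_i U\<close>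
  are only modules over the fixed ring. Twisting the coordinates by \<open>G\<close> and taking
  traces turns relations over the algebra into relations over the fixed ring, which is why the
  direct sum is finite. Characteristic zero enters through cancellation of the group order, both in
  the Maschke averaging and for traces on domains.\<close>

locale k_algebra = vector_space scale
  for scale :: "'k::field_char_0 \<Rightarrow> 'a::ring_1 \<Rightarrow> 'a" +
  assumes scale_mult_left: "scale c (a * b) = scale c a * b"
    and scale_mult_right: "scale c (a * b) = a * scale c b"

lemma kalgebra_iff: "kalgebra scale \<longleftrightarrow> k_algebra scale"
  by (auto simp: kalgebra_def k_algebra_def k_algebra_axioms_def)

text \<open>This is injectivity of the map from \<open>U^n\<close> sending \<open>z\<close> to the
  sum of the \<open>y i * z i\<close>: the sum of the \<open>y i U\<close> is direct and each
  \<open>y i\<close> acts injectively on \<open>U\<close>. The sequence \<open>y\<close> is total,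
  with only its first \<open>n\<close> terms relevant, so that a family can be prolonged term by
  term.\<close>

definition left_indep :: "'a::ring_1 set \<Rightarrow> (nat \<Rightarrow> 'a) \<Rightarrow> nat \<Rightarrow> bool" where
  "left_indep U y n \<longleftrightarrow>
     (\<forall>z. (\<forall>i<n. z i \<in> U) \<longrightarrow> (\<Sum>i<n. y i * z i) = 0 \<longrightarrow> (\<forall>i<n. z i = 0))"

lemma left_indepD:
  "left_indep U y n \<Longrightarrow> (\<And>i. i < n \<Longrightarrow> z i \<in> U) \<Longrightarrow> (\<Sum>i<n. y i * z i) = 0 \<Longrightarrow> i < n \<Longrightarrow> z i = 0"
  by (auto simp: left_indep_def)

lemma left_indep_Suc:
  assumes "left_indep U y (Suc n)" "0 \<in> U"
  shows "left_indep U y n"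
  unfolding left_indep_def
proof (intro allI impI)
  fix z i assume "\<forall>i<n. z i \<in> U" "(\<Sum>i<n. y i * z i) = 0" "i < n"
  thus "z i = 0"
    using left_indepD[OF assms(1), of "z(n := 0)" i] assms(2) by (auto split: if_splits)
qed

context k_algebra
begin

text \<open>\<open>dim\<close> is total and carries no information for spaces without a finite
  basis, so finiteness has to be carried along. Unlike \<open>fd_subspace\<close>, no carrier is
  named.\<close>

definition fin_dim :: "'a set \<Rightarrow> bool" where
  "fin_dim W \<longleftrightarrow> subspace W \<and> (\<exists>F. finite F \<and> span F = W)"

lemma fin_dim_subspace: "fin_dim W \<Longrightarrow> subspace W"
  by (simp add: fin_dim_def)

lemma fin_dim_span: "finite F \<Longrightarrow> fin_dim (span F)"
  by (auto simp: fin_dim_def)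

lemma fin_dim_basis:
  assumes "fin_dim W"
  obtains B where "finite B" "independent B" "span B = W" "card B = dim W" "B \<subseteq> W"
proof -
  obtain B where B: "B \<subseteq> W" "independent B" "W \<subseteq> span B" "card B = dim W"
    by (rule basis_exists)
  obtain F where "finite F" "span F = W"
    using assms by (auto simp: fin_dim_def)
  hence "finite B"
    using independent_span_bound[of F B] B by auto
  moreover have "span B = W"
    using B fin_dim_subspace[OF assms] by (simp add: span_minimal subset_antisym)
  ultimately show ?thesis using B that by blast
qed

lemma fin_dim_mono:
  assumes "fin_dim W" "subspace X" "X \<subseteq> W"
  shows "fin_dim X" "dim X \<le> dim W"
proof -
  obtain B where B: "finite B" "span B = W" "card B = dim W"
    using fin_dim_basis[OF assms(1)] by metis
  obtain C where C: "C \<subseteq> X" "independent C" "X \<subseteq> span C" "card C = dim X"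
    by (rule basis_exists)
  have *: "finite C \<and> card C \<le> card B"
    using independent_span_bound[of B C] B C assms by blast
  have "span C = X"
    using C assms(2) by (simp add: span_minimal subset_antisym)
  thus "fin_dim X" using * assms by (auto simp: fin_dim_def)
  show "dim X \<le> dim W" using * C B by simp
qed

lemma independent_Un_span:
  assumes "finite C" "independent B" "independent C" "span B \<inter> span C = {0}"
  shows "independent (B \<union> C)"
  using assms
proof (induction C)
  case (insert x C)
  have "span C \<subseteq> span (insert x C)" by (rule span_mono) auto
  hence int: "span B \<inter> span C = {0}"
    using insert.prems(3) span_zero by blast
  have ind: "independent (B \<union> C)"
    using insert int by (meson independent_mono subset_insertI)
  have "x \<notin> span (B \<union> C)"
  proof
    assume "x \<in> span (B \<union> C)"
    then obtain u v where uv: "x = u + v" "u \<in> span B" "v \<in> span C"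
      unfolding span_Un by blast
    have "u = x - v" using uv by simp
    hence "u \<in> span (insert x C)"
      using uv \<open>span C \<subseteq> span (insert x C)\<close> span_base[of x "insert x C"] span_diff by blast
    hence "u = 0" using uv insert.prems by blast
    hence "x \<in> span C" using uv by simp
    thus False using insert.prems(2) insert.hyps by (simp add: independent_insert)
  qed
  thus ?case using ind by (auto simp: independent_insert)
qed simp

lemma span_Int_of_independent:
  assumes "finite C" "independent (B \<union> C)" "B \<inter> C = {}"
  shows "span B \<inter> span C = {0}"
  using assms
proof (induction C)
  case (insert x C)
  have ind: "independent (B \<union> C)"
    using insert.prems by (simp add: independent_insert split: if_splits)
  hence int: "span B \<inter> span C = {0}" using insert by blast
  have nx: "x \<notin> span (B \<union> C)"
    using insert by (auto simp: independent_insert)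
  have "u = 0" if u: "u \<in> span B" "u \<in> span (insert x C)" for u
  proof -
    obtain k where k: "u - scale k x \<in> span C"
      using u(2) by (auto simp: span_insert)
    have "k = 0"
    proof (rule ccontr)
      assume "k \<noteq> 0"
      have "u \<in> span (B \<union> C)" "u - scale k x \<in> span (B \<union> C)"
        using k u(1) span_mono[of B "B \<union> C"] span_mono[of C "B \<union> C"] by auto
      hence "u - (u - scale k x) \<in> span (B \<union> C)" by (rule span_diff)
      hence "scale k x \<in> span (B \<union> C)" by simp
      hence "scale (inverse k) (scale k x) \<in> span (B \<union> C)"
        by (rule span_scale)
      thus False using nx \<open>k \<noteq> 0\<close> by simp
    qed
    thus ?thesis using k u int by auto
  qed
  thus ?case using span_zero by blast
qed (auto simp: span_zero)

lemma dim_sum_le: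
  assumes "fin_dim X" "fin_dim Y"
  shows "fin_dim (span (X \<union> Y))" "dim (span (X \<union> Y)) \<le> dim X + dim Y"
proof -
  obtain B where B: "finite B" "span B = X" "card B = dim X"
    using fin_dim_basis[OF assms(1)] by metis
  obtain C where C: "finite C" "span C = Y" "card C = dim Y"
    using fin_dim_basis[OF assms(2)] by metis
  have eq: "span (X \<union> Y) = span (B \<union> C)"
    unfolding span_Un B(2)[symmetric] C(2)[symmetric] span_span ..
  show "fin_dim (span (X \<union> Y))"
    unfolding eq using B C by (intro fin_dim_span) auto
  have "dim (span (B \<union> C)) \<le> card (B \<union> C)"
    using B C by (intro dim_le_card) auto
  also have "\<dots> \<le> dim X + dim Y"
    using card_Un_le[of B C] B C by simp
  finally show "dim (span (X \<union> Y)) \<le> dim X + dim Y" unfolding eq .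
qed

lemma dim_sum_direct:
  assumes "fin_dim X" "fin_dim Y" "X \<inter> Y = {0}"
  shows "dim (span (X \<union> Y)) = dim X + dim Y"
proof -
  obtain B where B: "finite B" "independent B" "span B = X" "card B = dim X"
    using fin_dim_basis[OF assms(1)] by metis
  obtain C where C: "finite C" "independent C" "span C = Y" "card C = dim Y"
    using fin_dim_basis[OF assms(2)] by metis
  have eq: "span (X \<union> Y) = span (B \<union> C)"
    unfolding span_Un B(3)[symmetric] C(3)[symmetric] span_span ..
  have "B \<inter> C = {}"
  proof -
    have "x = 0" if "x \<in> B" "x \<in> C" for x
      using that B C assms(3) span_base[of x B] span_base[of x C] by auto
    thus ?thesis using B(2) dependent_zero by blast
  qed
  moreover have "independent (B \<union> C)"
    using independent_Un_span[OF C(1) B(2) C(2)] assms(3) B C by simp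
  ultimately show ?thesis
    unfolding eq dim_span_eq_card_independent[OF \<open>independent (B \<union> C)\<close>]
    using B C by (simp add: card_Un_disjoint)
qed

lemma rank_nullity:
  assumes f: "Vector_Spaces.linear scale scale f" and W: "fin_dim W"
  shows "fin_dim (f ` W)" "dim W = dim (f ` W) + dim (W \<inter> {x. f x = 0})"
proof -
  interpret f: Vector_Spaces.linear scale scale f by (rule f)
  let ?K = "W \<inter> {x. f x = 0}"
  have K: "subspace ?K"
    using fin_dim_subspace[OF W] f.subspace_kernel by (simp add: subspace_inter)
  have "fin_dim ?K" using fin_dim_mono[OF W K] by simp
  then obtain B where B: "finite B" "independent B" "span B = ?K" "card B = dim ?K" "B \<subseteq> ?K"
    using fin_dim_basis by metis
  obtain D where D: "B \<subseteq> D" "D \<subseteq> W" "independent D" "W \<subseteq> span D"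
    using maximal_independent_subset_extend[of B W] B by auto
  have spD: "span D = W"
    using D fin_dim_subspace[OF W] by (simp add: span_minimal subset_antisym)
  obtain F where "finite F" "span F = W"
    using W by (auto simp: fin_dim_def)
  hence finD: "finite D" using independent_span_bound[of F D] D by auto
  define C where "C = D - B"
  have BC: "B \<union> C = D" "B \<inter> C = {}" "finite C"
    using D finD by (auto simp: C_def)
  have int: "span B \<inter> span C = {0}"
    using span_Int_of_independent[of C B] BC D by simp
  have CW: "span C \<subseteq> W" using spD span_mono[of C D] BC by auto
  have inj: "inj_on f (span C)"
  proof (rule inj_onI)
    fix x y assume xy: "x \<in> span C" "y \<in> span C" "f x = f y"
    hence "x - y \<in> span C" by (simp add: span_diff)
    moreover have "x - y \<in> span B"
      unfolding B(3) using xy CW calculation by (auto simp: f.diff)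
    ultimately have "x - y \<in> {0}" using int by blast
    thus "x = y" by simp
  qed
  have "independent C" using D(3) BC independent_mono by blast
  hence "independent (f ` C)"
    using inj by (rule f.independent_injective_image)
  moreover have "inj_on f C"
    using inj span_superset by (rule inj_on_subset)
  moreover have "f ` W = span (f ` C)"
  proof -
    have "f ` W = span (f ` D)" unfolding f.span_image spD ..
    also have "\<dots> = span (f ` C)"
    proof (rule span_eq[THEN iffD2], intro conjI)
      have "f x \<in> span (f ` C)" if "x \<in> D" for x
        using that BC B(5) span_base[of "f x" "f ` C"] span_zero by fastforce
      thus "f ` D \<subseteq> span (f ` C)" by blast
      have "C \<subseteq> D" using BC by blast
      thus "f ` C \<subseteq> span (f ` D)" by (rule subset_trans[OF image_mono span_superset])
    qed
    finally show ?thesis .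
  qed
  ultimately have "dim (f ` W) = card C" and *: "f ` W = span (f ` C)"
    using dim_span_eq_card_independent[of "f ` C"] card_image[of f C] by (simp_all del: dim_span)
  moreover have "dim W = card D"
    using D by (metis dim_span_eq_card_independent spD)
  moreover have "card D = card B + card C"
    using BC B(1) by (metis card_Un_disjoint)
  ultimately show "dim W = dim (f ` W) + dim ?K" using B by simp
  show "fin_dim (f ` W)" unfolding * using BC by (intro fin_dim_span) auto
qed


lemma fin_dim_zero: "fin_dim {0}" "dim {0} = 0"
proof -
  show "fin_dim {0}" using fin_dim_span[of "{}"] by simp
  show "dim {0} = 0" using dim_span_eq_card_independent[OF independent_empty] by simp
qed

lemma dim_pos:
  assumes "fin_dim W" "W \<noteq> {0}"
  shows "0 < dim W"
proof (rule ccontr)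
  assume "\<not> 0 < dim W"
  moreover obtain B where "finite B" "span B = W" "card B = dim W"
    using fin_dim_basis[OF assms(1)] by metis
  ultimately show False using assms(2) by simp
qed

lemma dim_image_le:
  assumes "Vector_Spaces.linear scale scale f" "fin_dim W"
  shows "dim (f ` W) \<le> dim W"
  using rank_nullity(2)[OF assms] by simp

lemma dim_image_eq:
  assumes "Vector_Spaces.linear scale scale f" "fin_dim W" "\<And>w. w \<in> W \<Longrightarrow> f w = 0 \<Longrightarrow> w = 0"
  shows "dim (f ` W) = dim W"
proof -
  interpret f: Vector_Spaces.linear scale scale f by (rule assms(1))
  have "W \<inter> {x. f x = 0} = {0}"
    using assms(3) subspace_0[OF fin_dim_subspace[OF assms(2)]] by auto
  thus ?thesis using rank_nullity(2)[OF assms(1,2)] fin_dim_zero by simp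
qed

lemma linear_mult_left: "Vector_Spaces.linear scale scale ((*) a)"
  by (unfold_locales) (auto simp: algebra_simps scale_mult_right)

lemma mult_in_mult_space: "v \<in> V \<Longrightarrow> w \<in> W \<Longrightarrow> v * w \<in> mult_space scale V W"
  by (auto simp: mult_space_def intro: span_base)

lemma subspace_mult_space: "subspace (mult_space scale V W)"
  by (simp add: mult_space_def)

lemma mult_space_minimal:
  assumes "subspace X" "\<And>v w. v \<in> V \<Longrightarrow> w \<in> W \<Longrightarrow> v * w \<in> X"
  shows "mult_space scale V W \<subseteq> X"
  unfolding mult_space_def using assms by (intro span_minimal) auto

lemma mult_mem_span:
  assumes X: "subspace X" and FH: "\<And>f h. f \<in> F \<Longrightarrow> h \<in> H \<Longrightarrow> f * h \<in> X"
    and v: "v \<in> span F" and w: "w \<in> span H"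
  shows "v * w \<in> X"
proof -
  have *: "f * w \<in> X" if "f \<in> F" for f
    using w
  proof (induction rule: span_induct)
    show "subspace {a. f * a \<in> X}"
      using X by (auto simp: subspace_def distrib_left scale_mult_right[symmetric])
  qed (use that FH in auto)
  show ?thesis using v
  proof (induction rule: span_induct)
    show "subspace {a. a * w \<in> X}"
      using X by (auto simp: subspace_def distrib_right scale_mult_left[symmetric])
  qed (use * in auto)
qed

lemma mult_space_span:
  "mult_space scale (span F) (span H) = span {f * h | f h. f \<in> F \<and> h \<in> H}"
proof
  show "mult_space scale (span F) (span H) \<subseteq> span {f * h | f h. f \<in> F \<and> h \<in> H}"
  proof (rule mult_space_minimal)
    show "v * w \<in> span {f * h | f h. f \<in> F \<and> h \<in> H}" if "v \<in> span F" "w \<in> span H" for v w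
      by (rule mult_mem_span[OF _ _ that]) (auto intro: span_base)
  qed simp
  show "span {f * h | f h. f \<in> F \<and> h \<in> H} \<subseteq> mult_space scale (span F) (span H)"
    unfolding mult_space_def by (intro span_mono) (auto intro: span_base)
qed

lemma fin_dim_mult_space:
  assumes "fin_dim V" "fin_dim W"
  shows "fin_dim (mult_space scale V W)"
proof -
  obtain F H where FH: "finite F" "span F = V" "finite H" "span H = W"
    using assms by (auto simp: fin_dim_def)
  have "{f * h | f h. f \<in> F \<and> h \<in> H} = (\<lambda>(f, h). f * h) ` (F \<times> H)" by auto
  hence "finite {f * h | f h. f \<in> F \<and> h \<in> H}" using FH by simp
  thus ?thesis using mult_space_span[of F H] FH by (simp add: fin_dim_span)
qed

lemma UN_lessThan_Suc: "(\<Union>i<Suc n. X i) = (\<Union>i<n. X i) \<union> X n"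
  by (auto simp: less_Suc_eq)

lemma span_UN_images:
  fixes n :: nat
  assumes "\<And>i. i < n \<Longrightarrow> subspace (Z i)" "x \<in> span (\<Union>i<n. (*) (y i) ` Z i)"
  shows "\<exists>z. (\<forall>i<n. z i \<in> Z i) \<and> x = (\<Sum>i<n. y i * z i)"
  using assms
proof (induction n arbitrary: x)
  case (Suc n)
  have "span (\<Union>i<Suc n. (*) (y i) ` Z i) = span ((\<Union>i<n. (*) (y i) ` Z i) \<union> (*) (y n) ` Z n)"
    unfolding UN_lessThan_Suc ..
  then obtain u v where uv: "x = u + v" "u \<in> span (\<Union>i<n. (*) (y i) ` Z i)" "v \<in> span ((*) (y n) ` Z n)"
    using Suc.prems(2) unfolding span_Un by blast
  interpret f: Vector_Spaces.linear scale scale "(*) (y n)" by (rule linear_mult_left)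
  have "v \<in> (*) (y n) ` Z n"
    using uv(3) Suc.prems(1)[of n] unfolding f.span_image by (metis lessI span_eq_iff)
  then obtain t where t: "t \<in> Z n" "v = y n * t" by blast
  obtain z where "\<forall>i<n. z i \<in> Z i" "u = (\<Sum>i<n. y i * z i)"
    using Suc.IH[OF _ uv(2)] Suc.prems(1) by auto
  thus ?case using t uv(1) by (intro exI[of _ "z(n := t)"]) (auto simp: less_Suc_eq)
qed simp

lemma dim_UN_images_le:
  fixes n :: nat
  assumes "\<And>i. i < n \<Longrightarrow> fin_dim (Z i)"
  shows "fin_dim (span (\<Union>i<n. (*) (y i) ` Z i)) \<and>
         dim (span (\<Union>i<n. (*) (y i) ` Z i)) \<le> (\<Sum>i<n. dim (Z i))"
  using assms
proof (induction n)
  case 0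
  show ?case using fin_dim_zero by simp
next
  case (Suc n)
  let ?X = "span (\<Union>i<n. (*) (y i) ` Z i)" and ?Y = "(*) (y n) ` Z n"
  have IH: "fin_dim ?X" "dim ?X \<le> (\<Sum>i<n. dim (Z i))" using Suc by auto
  have Y: "fin_dim ?Y" "dim ?Y \<le> dim (Z n)"
    using rank_nullity(1)[OF linear_mult_left] dim_image_le[OF linear_mult_left] Suc.prems by auto
  have "span (\<Union>i<Suc n. (*) (y i) ` Z i) = span (?X \<union> ?Y)"
    unfolding UN_lessThan_Suc span_Un span_span ..
  thus ?case using dim_sum_le[OF IH(1) Y(1)] IH Y by simp
qed

text \<open>Independence is used twice: each \<open>y i\<close> preserves the dimension of
  \<open>Z i\<close>, and an element common to the last summand and the earlier ones would be a
  relation with last coefficient \<open>- t\<close>.\<close>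

lemma dim_UN_images_eq:
  fixes n :: nat
  assumes "\<And>i. i < n \<Longrightarrow> fin_dim (Z i)" "\<And>i. i < n \<Longrightarrow> Z i \<subseteq> U" "0 \<in> U"
    and "subspace U" "left_indep U y n"
  shows "dim (span (\<Union>i<n. (*) (y i) ` Z i)) = (\<Sum>i<n. dim (Z i))"
  using assms
proof (induction n)
  case 0
  show ?case using fin_dim_zero by simp
next
  case (Suc n)
  let ?X = "span (\<Union>i<n. (*) (y i) ` Z i)" and ?Y = "(*) (y n) ` Z n"
  have IH: "dim ?X = (\<Sum>i<n. dim (Z i))"
    using Suc left_indep_Suc[OF Suc.prems(5,3)] by simp
  have X: "fin_dim ?X" using dim_UN_images_le[of n Z y] Suc.prems(1) by simp
  have inj: "z = 0" if "z \<in> Z n" "y n * z = 0" for z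
    using left_indepD[OF Suc.prems(5), of "(\<lambda>_. 0)(n := z)" n] that Suc.prems(2)[of n] Suc.prems(3)
    by auto
  have Y: "fin_dim ?Y" "dim ?Y = dim (Z n)"
    using rank_nullity(1)[OF linear_mult_left] dim_image_eq[OF linear_mult_left _ inj] Suc.prems by auto
  have "x = 0" if x: "x \<in> ?X" "x \<in> ?Y" for x
  proof -
    obtain z where z: "\<forall>i<n. z i \<in> Z i" "x = (\<Sum>i<n. y i * z i)"
      using span_UN_images[OF _ x(1)] Suc.prems(1) fin_dim_subspace by auto
    obtain t where t: "t \<in> Z n" "x = y n * t" using x by blast
    have "- t \<in> U" using t Suc.prems(2,4) by (meson lessI subsetD subspace_neg)
    moreover have "z i \<in> U" if "i < n" for i using z that Suc.prems(2) by (meson less_SucI subsetD)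
    ultimately have "(z(n := - t)) i \<in> U" if "i < Suc n" for i
      using that by (auto simp: less_Suc_eq)
    moreover have "(\<Sum>i<n. y i * (z(n := - t)) i) = (\<Sum>i<n. y i * z i)"
      by (intro sum.cong) auto
    hence "(\<Sum>i<Suc n. y i * (z(n := - t)) i) = 0"
      using z(2) t(2) by (simp del: fun_upd_apply add: fun_upd_same)
    ultimately have "(z(n := - t)) n = 0"
      using left_indepD[OF Suc.prems(5), of "z(n := - t)" n] by blast
    thus "x = 0" using t by simp
  qed
  hence "?X \<inter> ?Y = {0}"
    using span_zero subspace_0[OF fin_dim_subspace[OF Y(1)]] by auto
  moreover have "span (\<Union>i<Suc n. (*) (y i) ` Z i) = span (?X \<union> ?Y)"
    unfolding UN_lessThan_Suc span_Un span_span ..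
  ultimately show ?case using dim_sum_direct[OF X Y(1)] IH Y by simp
qed

text \<open>Rank-nullity is applied to \<open>u n\<close> on the common kernel of the earlier
  multiplications, whose image is no larger than that of all of \<open>W\<close>.\<close>

lemma dim_le_sum_dim_images:
  fixes n :: nat
  assumes "fin_dim W"
  shows "dim W \<le> (\<Sum>i<n. dim ((*) (u i) ` W)) + dim (W \<inter> {w. \<forall>i<n. u i * w = 0})"
proof (induction n)
  case (Suc n)
  let ?K = "W \<inter> {w. \<forall>i<n. u i * w = 0}"
  have "subspace ?K"
    using fin_dim_subspace[OF assms]
    by (auto simp: subspace_def distrib_left scale_mult_right[symmetric])
  hence K: "fin_dim ?K" using fin_dim_mono[OF assms] by blast
  have "?K \<inter> {w. u n * w = 0} = W \<inter> {w. \<forall>i<Suc n. u i * w = 0}"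
    by (auto simp: less_Suc_eq)
  hence eq: "dim ?K = dim ((*) (u n) ` ?K) + dim (W \<inter> {w. \<forall>i<Suc n. u i * w = 0})"
    using rank_nullity(2)[OF linear_mult_left K, of "u n"] by simp
  have "dim ((*) (u n) ` ?K) \<le> dim ((*) (u n) ` W)"
    by (rule fin_dim_mono[OF rank_nullity(1)[OF linear_mult_left assms]
          fin_dim_subspace[OF rank_nullity(1)[OF linear_mult_left K]]]) auto
  thus ?case using Suc eq by simp
qed simp

end

section \<open>Growth inequalities and lower transcendence degree\<close>

text \<open>After writing \<open>t powr e = t * t powr (e - 1)\<close>, the second factor is
  antitone. This covers negative \<open>e\<close> as well, which occurs for
  \<open>d < 1\<close>.\<close>

lemma powr_subadditive:
  fixes x y e :: real
  assumes "0 < x" "0 < y" "e \<le> 1"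
  shows "(x + y) powr e \<le> x powr e + y powr e"
proof -
  have *: "t powr e = t * t powr (e - 1)" if "0 < t" for t :: real
    using that powr_mult_base[of t "e - 1"] by simp
  have "(x + y) powr e = x * (x + y) powr (e - 1) + y * (x + y) powr (e - 1)"
    using *[of "x + y"] assms by (simp add: distrib_right)
  also have "\<dots> \<le> x * x powr (e - 1) + y * y powr (e - 1)"
    using assms by (intro add_mono mult_left_mono powr_mono2') auto
  finally show ?thesis using * assms by simp
qed

text \<open>The lower bound in the definition of \<open>LD\<close> as a function of
  \<open>dim W\<close>. Since \<open>0 powr e = 0\<close>, it vanishes at 0, so zero subspaces
  satisfy the inequality trivially.\<close>

definition growth :: "real \<Rightarrow> real \<Rightarrow> nat \<Rightarrow> real" where
  "growth d c n = real n + c * real n powr ((d - 1) / d)"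

lemma growth_0 [simp]: "growth d c 0 = 0"
  by (simp add: growth_def)

lemma exponent_le_1: "0 < d \<Longrightarrow> (d - 1) / d \<le> (1 :: real)"
  by simp

lemma growth_add:
  assumes "0 < d" "0 < c"
  shows "growth d c (m + n) \<le> growth d c m + growth d c n"
proof (cases "m = 0 \<or> n = 0")
  case False
  hence "c * (real m + real n) powr ((d - 1) / d)
      \<le> c * (real m powr ((d - 1) / d) + real n powr ((d - 1) / d))"
    using assms by (intro mult_left_mono powr_subadditive) (auto simp: exponent_le_1)
  thus ?thesis by (simp add: growth_def distrib_left)
qed auto

lemma growth_sum:
  assumes "0 < d" "0 < c"
  shows "growth d c (\<Sum>i\<in>I. f i) \<le> (\<Sum>i\<in>I. growth d c (f i))"
proof (induction I rule: infinite_finite_induct)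
  case (insert i I)
  thus ?case using growth_add[OF assms, of "f i" "sum f I"] by simp
qed auto

text \<open>For \<open>d < 1\<close> the exponent is negative and monotonicity needs \<open>c \<le> 1\<close>.\<close>
lemma growth_mono:
  assumes "0 < d" "0 < c" "c \<le> 1" "m \<le> n"
  shows "growth d c m \<le> growth d c n"
proof (cases "m = 0 \<or> m = n")
  case True
  thus ?thesis using assms by (auto simp: growth_def)
next
  case False
  let ?e = "(d - 1) / d"
  have mn: "real m + 1 \<le> real n" using False assms by simp
  show ?thesis
  proof (cases "?e \<ge> 0")
    case True
    thus ?thesis unfolding growth_def
      using assms by (intro add_mono mult_left_mono powr_mono2) auto
  next
    case e: False
    have "real m powr ?e \<le> real m powr 0"
      using e False by (intro powr_mono) auto
    hence "c * real m powr ?e \<le> 1 * 1"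
      using assms False by (intro mult_mono) auto
    moreover have "0 \<le> c * real n powr ?e" using assms by simp
    ultimately show ?thesis using mn by (simp add: growth_def)
  qed
qed

lemma growth_mono_const: "c \<le> c' \<Longrightarrow> growth d c n \<le> growth d c' n"
  by (simp add: growth_def mult_right_mono)

section \<open>The growth inequality for subspaces and its transfer between rings\<close>

context k_algebra
begin

text \<open>The volume difference inequality. \<open>V\<close> is independent of \<open>S\<close>,
  so that one \<open>V\<close> can be tested on subspaces of the fixed ring and of the whole
  algebra.\<close>

definition vdi :: "real \<Rightarrow> real \<Rightarrow> 'a set \<Rightarrow> 'a set \<Rightarrow> bool" where
  "vdi d c S V \<longleftrightarrow>
     (\<forall>W. fd_subspace scale S W \<and> W \<noteq> {0} \<longrightarrow>
        growth d c (dim W) \<le> real (dim (mult_space scale V W)))"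

lemma fd_subspace_iff: "fd_subspace scale S W \<longleftrightarrow> W \<subseteq> S \<and> fin_dim W"
  by (auto simp: fd_subspace_def fin_dim_def)

lemma vdiD:
  assumes "vdi d c S V" "W \<subseteq> S" "fin_dim W"
  shows "growth d c (dim W) \<le> real (dim (mult_space scale V W))"
proof (cases "W = {0}")
  case True
  thus ?thesis using fin_dim_zero by simp
qed (use assms in \<open>simp add: vdi_def fd_subspace_iff\<close>)

lemma LD_eq:
  "LD scale S =
     (if \<forall>V. subframe scale S V \<longrightarrow>
            (\<exists>W. fd_subspace scale S W \<and> W \<noteq> {0} \<and> dim (mult_space scale V W) = dim W)
      then 0
      else SUP V\<in>{V. subframe scale S V}. SUP d\<in>{d. d > 0 \<and> (\<exists>c>0. vdi d c S V)}. ereal d)"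
  unfolding LD_def vdi_def growth_def by simp

lemma subset_mult_space:
  assumes "1 \<in> V" shows "W \<subseteq> mult_space scale V W"
  using mult_in_mult_space[OF assms] by fastforce

text \<open>Dimensions are integers, so a strict increase is an increase by at least 1, which is the
  bound for \<open>d = 1\<close> because the exponent is then 0. Thus the degenerate branch of
  \<open>LD\<close> is exactly the absence of such inequalities.\<close>

lemma vdi_one:
  assumes "subframe scale S V"
    and "\<And>W. fd_subspace scale S W \<Longrightarrow> W \<noteq> {0} \<Longrightarrow> dim (mult_space scale V W) \<noteq> dim W"
  shows "vdi 1 1 S V"
  unfolding vdi_def
proof (intro allI impI)
  fix W assume "fd_subspace scale S W \<and> W \<noteq> {0}"
  hence W: "fd_subspace scale S W" "W \<noteq> {0}" by auto
  have V: "fin_dim V" "1 \<in> V" using assms(1) by (auto simp: subframe_def fd_subspace_iff)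
  have fW: "fin_dim W" using W by (simp add: fd_subspace_iff)
  have "dim W \<le> dim (mult_space scale V W)"
    using fin_dim_mono(2)[OF fin_dim_mult_space[OF V(1) fW] fin_dim_subspace[OF fW]]
      subset_mult_space[OF V(2)] by blast
  hence "real (dim W) + 1 \<le> real (dim (mult_space scale V W))"
    using assms(2)[OF W] by linarith
  thus "growth 1 1 (dim W) \<le> real (dim (mult_space scale V W))"
    using dim_pos[OF fW W(2)] by (simp add: growth_def)
qed

lemma not_degenerate_of_vdi:
  assumes "subframe scale S V" "vdi d c S V" "0 < c"
    and "fd_subspace scale S W" "W \<noteq> {0}"
  shows "dim (mult_space scale V W) \<noteq> dim W"
proof -
  have "0 < dim W" using assms(4,5) dim_pos by (simp add: fd_subspace_iff)
  hence "real (dim W) < growth d c (dim W)" using assms(3) by (simp add: growth_def)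
  also have "\<dots> \<le> real (dim (mult_space scale V W))"
    using assms by (auto simp: vdi_def)
  finally show ?thesis by simp
qed

lemma LD_nonneg: "0 \<le> LD scale S"
proof (cases "\<forall>V. subframe scale S V \<longrightarrow>
            (\<exists>W. fd_subspace scale S W \<and> W \<noteq> {0} \<and> dim (mult_space scale V W) = dim W)")
  case False
  then obtain V where V: "subframe scale S V"
    "\<And>W. fd_subspace scale S W \<Longrightarrow> W \<noteq> {0} \<Longrightarrow> dim (mult_space scale V W) \<noteq> dim W"
    by blast
  have "vdi 1 1 S V" using vdi_one[OF V] .
  hence "ereal 1 \<le> (SUP V\<in>{V. subframe scale S V}. SUP d\<in>{d. d > 0 \<and> (\<exists>c>0. vdi d c S V)}. ereal d)"
    using V(1) by (intro SUP_upper2[of V] SUP_upper2[of 1]) (auto intro: exI[of _ 1])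
  moreover have "(0 :: ereal) \<le> ereal 1" by simp
  ultimately show ?thesis unfolding LD_eq if_not_P[OF False] by (rule order_trans[rotated])
qed (simp add: LD_eq)

text \<open>One hypothesis serves both branches of \<open>LD\<close>: if \<open>S\<close> is
  nondegenerate, \<open>vdi 1 1\<close> holds for some subframe, and its transfer to
  \<open>T\<close> shows that \<open>T\<close> is nondegenerate too.\<close>

lemma LD_le:
  assumes "\<And>V d c. subframe scale S V \<Longrightarrow> 0 < d \<Longrightarrow> 0 < c \<Longrightarrow> vdi d c S V \<Longrightarrow>
             \<exists>V' c'. subframe scale T V' \<and> 0 < c' \<and> vdi d c' T V'"
  shows "LD scale S \<le> LD scale T"
proof (cases "\<forall>V. subframe scale S V \<longrightarrow>
            (\<exists>W. fd_subspace scale S W \<and> W \<noteq> {0} \<and> dim (mult_space scale V W) = dim W)")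
  case True
  thus ?thesis using LD_nonneg[of T] by (simp add: LD_eq[of S])
next
  case False
  then obtain V where V: "subframe scale S V"
    "\<And>W. fd_subspace scale S W \<Longrightarrow> W \<noteq> {0} \<Longrightarrow> dim (mult_space scale V W) \<noteq> dim W"
    by blast
  obtain V' c' where V': "subframe scale T V'" "0 < c'" "vdi 1 c' T V'"
    using assms[OF V(1) _ _ vdi_one[OF V]] by auto
  have nd: "\<not> (\<forall>V. subframe scale T V \<longrightarrow>
            (\<exists>W. fd_subspace scale T W \<and> W \<noteq> {0} \<and> dim (mult_space scale V W) = dim W))"
    using not_degenerate_of_vdi[OF V'(1,3,2)] V'(1) by blast
  have "(SUP V\<in>{V. subframe scale S V}. SUP d\<in>{d. d > 0 \<and> (\<exists>c>0. vdi d c S V)}. ereal d)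
      \<le> (SUP V\<in>{V. subframe scale T V}. SUP d\<in>{d. d > 0 \<and> (\<exists>c>0. vdi d c T V)}. ereal d)"
  proof (intro SUP_least)
    fix V d assume "V \<in> {V. subframe scale S V}" "d \<in> {d. d > 0 \<and> (\<exists>c>0. vdi d c S V)}"
    then obtain c where "subframe scale S V" "0 < d" "0 < c" "vdi d c S V" by auto
    then obtain V' c' where "subframe scale T V'" "0 < c'" "vdi d c' T V'"
      using assms by blast
    thus "ereal d \<le> (SUP V\<in>{V. subframe scale T V}. SUP d\<in>{d. d > 0 \<and> (\<exists>c>0. vdi d c T V)}. ereal d)"
      using \<open>0 < d\<close> by (intro SUP_upper2[of V'] SUP_upper2[of d]) auto
  qed
  thus ?thesis unfolding LD_eq if_not_P[OF False] if_not_P[OF nd] .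
qed

text \<open>Induction on \<open>dim W\<close>. A map \<open>f\<close> that is nonzero on
  \<open>W\<close> splits \<open>W\<close> into an image inside \<open>S\<close> and a smaller
  kernel; correspondingly \<open>VW\<close> has image containing \<open>V f(W)\<close> and kernel
  containing \<open>V (W \<inter> ker f)\<close>. Subadditivity of \<open>growth\<close> combines
  the two bounds without loss in \<open>c\<close>.\<close>

lemma vdi_of_torsionless:
  assumes vdi: "vdi d c S V" and pos: "0 < d" "0 < c" and V: "fin_dim V"
    and sep: "\<And>a. a \<noteq> 0 \<Longrightarrow> \<exists>f. Vector_Spaces.linear scale scale f \<and> range f \<subseteq> S \<and>
                 (\<forall>v\<in>V. \<forall>x. f (v * x) = v * f x) \<and> f a \<noteq> 0"
  shows "vdi d c UNIV V"
proof -
  have "growth d c (dim W) \<le> real (dim (mult_space scale V W))" if "fin_dim W" for W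
    using that
  proof (induction "dim W" arbitrary: W rule: less_induct)
    case less
    show ?case
    proof (cases "W = {0}")
      case True
      thus ?thesis using fin_dim_zero by simp
    next
      case False
      then obtain a where a: "a \<in> W" "a \<noteq> 0"
        using subspace_0[OF fin_dim_subspace[OF less.prems]] by blast
      obtain f where lin: "Vector_Spaces.linear scale scale f" and f: "range f \<subseteq> S"
        "\<And>v x. v \<in> V \<Longrightarrow> f (v * x) = v * f x" "f a \<noteq> 0"
        using sep[OF a(2)] by blast
      interpret f: Vector_Spaces.linear scale scale f by (rule lin)
      let ?K = "W \<inter> {x. f x = 0}"
      have sK: "subspace ?K"
        using fin_dim_subspace[OF less.prems] f.subspace_kernel by (simp add: subspace_inter)
      have K: "fin_dim ?K" using fin_dim_mono[OF less.prems sK] by simp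
      note rn = rank_nullity[OF lin less.prems]
      have "f ` W \<noteq> {0}" using a f(3) by auto
      hence "dim ?K < dim W" using rn dim_pos[OF rn(1)] by simp
      hence IH: "growth d c (dim ?K) \<le> real (dim (mult_space scale V ?K))"
        using less.hyps K by blast
      let ?M = "mult_space scale V W"
      have M: "fin_dim ?M" by (rule fin_dim_mult_space[OF V less.prems])
      note rnM = rank_nullity[OF lin M]
      have "mult_space scale V (f ` W) \<subseteq> f ` ?M"
        using f(2) mult_in_mult_space
        by (intro mult_space_minimal fin_dim_subspace[OF rnM(1)]) (auto simp flip: f(2))
      hence 1: "dim (mult_space scale V (f ` W)) \<le> dim (f ` ?M)"
        using fin_dim_mono(2)[OF rnM(1)] subspace_mult_space by blast
      have sKM: "subspace (?M \<inter> {x. f x = 0})"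
        using fin_dim_subspace[OF M] f.subspace_kernel by (simp add: subspace_inter)
      have "mult_space scale V ?K \<subseteq> ?M \<inter> {x. f x = 0}"
        using f(2) mult_in_mult_space by (intro mult_space_minimal sKM) auto
      hence 2: "dim (mult_space scale V ?K) \<le> dim (?M \<inter> {x. f x = 0})"
        using fin_dim_mono(2)[OF fin_dim_mono(1)[OF M sKM]] subspace_mult_space by blast
      have "growth d c (dim W) \<le> growth d c (dim (f ` W)) + growth d c (dim ?K)"
        unfolding rn(2) by (rule growth_add[OF pos])
      also have "growth d c (dim (f ` W)) \<le> real (dim (mult_space scale V (f ` W)))"
        using f(1) by (intro vdiD[OF vdi _ rn(1)]) auto
      finally show ?thesis using IH 1 2 rnM(2) by simp
    qed
  qed
  thus ?thesis by (simp add: vdi_def fd_subspace_iff)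
qed

text \<open>Inside a right ideal \<open>U\<close> of the small ring, \<open>V\<close> acts on \<open>x\<^sub>0 U \<oplus> \<dots> \<oplus> x\<^sub>l\<^sub>-\<^sub>1 U\<close> through an
  \<open>l \<times> l\<close> matrix with entries in \<open>span K\<close>.\<close>
lemma growth_in_right_ideal:
  assumes vdi: "vdi d c UNIV V" and pos: "0 < d" "0 < c" and V: "fin_dim V"
    and U: "subspace U" and l: "0 < l" and indep: "left_indep U x l"
    and s: "\<And>u. u \<in> U \<Longrightarrow> s * u \<in> U" "\<And>u. u \<in> U \<Longrightarrow> s * u = 0 \<Longrightarrow> u = 0"
    and K: "finite K" "\<And>k u. k \<in> K \<Longrightarrow> u \<in> U \<Longrightarrow> k * u \<in> U"
    and mat: "\<And>v j. v \<in> V \<Longrightarrow> j < l \<Longrightarrow> v * (x j * s) \<in> span (\<Union>i<l. (*) (x i) ` span K)"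
    and W: "fin_dim W" "W \<subseteq> U"
  shows "growth d (c * real l powr ((d - 1) / d - 1)) (dim W)
           \<le> real (dim (mult_space scale (span K) W))"
proof -
  let ?e = "(d - 1) / d"
  \<comment> \<open>The factor \<open>s\<close> clears denominators: \<open>v * x j\<close> need not
    lie in the sum of the \<open>x i U\<close>, but \<open>v * x j * s\<close> does. Injectivity of
    \<open>s\<close> on \<open>U\<close> keeps the dimension.\<close>
  define X where "X = span (\<Union>j<l. (*) (x j) ` ((*) s ` W))"
  let ?Z = "mult_space scale (span K) W"
  have sW: "fin_dim ((*) s ` W)" "dim ((*) s ` W) = dim W"
    using rank_nullity(1)[OF linear_mult_left W(1)] dim_image_eq[OF linear_mult_left W(1)] s(2) W(2)
    by blast+
  have sWU: "(*) s ` W \<subseteq> U" using s(1) W(2) by blast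
  have X: "fin_dim X" "dim X = l * dim W"
    unfolding X_def
    using dim_UN_images_le[of l "\<lambda>_. (*) s ` W" x] sW
      dim_UN_images_eq[of l "\<lambda>_. (*) s ` W" U x] subspace_0[OF U] U sWU indep
    by auto
  have Z: "fin_dim ?Z" by (intro fin_dim_mult_space fin_dim_span K(1) W(1))
  let ?Y = "span (\<Union>i<l. (*) (x i) ` ?Z)"
  have Y: "fin_dim ?Y" "dim ?Y \<le> l * dim ?Z"
    using dim_UN_images_le[of l "\<lambda>_. ?Z" x] Z by auto
  have gen: "v * (x j * (s * w)) \<in> ?Y" if "v \<in> V" "j < l" "w \<in> W" for v j w
  proof -
    have "(v * (x j * s)) * w \<in> ?Y"
    proof (rule mult_mem_span)
      show "v * (x j * s) \<in> span (\<Union>i<l. (*) (x i) ` span K)" using mat that by blast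
      show "w \<in> span {w}" by (simp add: span_base)
      fix f h assume "f \<in> (\<Union>i<l. (*) (x i) ` span K)" "h \<in> {w}"
      then obtain i k where ik: "i < l" "k \<in> span K" "f * h = x i * (k * w)"
        by (auto simp: mult.assoc)
      thus "f * h \<in> ?Y" using mult_in_mult_space[of k "span K" w W] that(3)
        by (auto intro!: span_base)
    qed simp
    thus ?thesis by (simp add: mult.assoc)
  qed
  have "mult_space scale V X \<subseteq> ?Y"
  proof (rule mult_space_minimal)
    fix v y assume vy: "v \<in> V" "y \<in> X"
    show "v * y \<in> ?Y"
    proof (rule mult_mem_span)
      show "v \<in> span {v}" by (simp add: span_base)
      show "y \<in> span (\<Union>j<l. (*) (x j) ` ((*) s ` W))" using vy by (simp add: X_def)
    qed (use gen vy in auto)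
  qed simp
  hence "dim (mult_space scale V X) \<le> dim ?Y"
    using fin_dim_mono(2)[OF Y(1) subspace_mult_space] by blast
  also note Y(2)
  finally have "growth d c (l * dim W) \<le> real (l * dim ?Z)"
    using vdiD[OF vdi _ X(1)] unfolding X(2) by (meson of_nat_le_iff order_trans subset_UNIV)
  \<comment> \<open>Origin of the constant: \<open>dim X\<close> is \<open>l * dim W\<close>, and
    dividing its power by \<open>l\<close> leaves the factor
    \<open>real l powr (?e - 1)\<close>.\<close>
  moreover have "growth d c (l * dim W) = real l * growth d (c * real l powr (?e - 1)) (dim W)"
  proof -
    have "real l powr ?e = real l * real l powr (?e - 1)"
      using l powr_mult_base[of "real l" "?e - 1"] by simp
    thus ?thesis by (simp add: growth_def powr_mult distrib_left mult_ac)
  qed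
  ultimately show ?thesis using l by simp
qed

text \<open>A finite-dimensional \<open>W\<close> is cut into the slices \<open>u\<^sub>i W \<subseteq> U\<close>, which the \<open>b\<^sub>i\<close> put in
  direct position again.\<close>
lemma vdi_of_slices:
  fixes n :: nat
  assumes gr: "\<And>W. fin_dim W \<Longrightarrow> W \<subseteq> U \<Longrightarrow>
                 growth d c (dim W) \<le> real (dim (mult_space scale (span K) W))"
    and pos: "0 < d" "0 < c" "c \<le> 1"
    and U: "subspace U" and K: "finite K" "\<And>k u. k \<in> K \<Longrightarrow> u \<in> U \<Longrightarrow> k * u \<in> U"
    and indep: "left_indep U b n"
    and u: "\<And>i w. i < n \<Longrightarrow> w \<in> S \<Longrightarrow> u i * w \<in> U"
    and inj: "\<And>w. w \<in> S \<Longrightarrow> (\<forall>i<n. u i * w = 0) \<Longrightarrow> w = 0"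
  shows "vdi d c S (span (insert 1 {b i * k * u i | i k. i < n \<and> k \<in> K}))"
  unfolding vdi_def
proof (intro allI impI)
  fix W assume "fd_subspace scale S W \<and> W \<noteq> {0}"
  hence W: "fin_dim W" "W \<subseteq> S" by (auto simp: fd_subspace_iff)
  let ?V = "span (insert 1 {b i * k * u i | i k. i < n \<and> k \<in> K})"
  have "{b i * k * u i | i k. i < n \<and> k \<in> K} = (\<lambda>(i, k). b i * k * u i) ` ({..<n} \<times> K)" by auto
  hence V: "fin_dim ?V" using K(1) by (intro fin_dim_span) simp
  let ?Z = "\<lambda>i. mult_space scale (span K) ((*) (u i) ` W)"
  have uW: "fin_dim ((*) (u i) ` W)" for i by (rule rank_nullity(1)[OF linear_mult_left W(1)])
  have Z: "fin_dim (?Z i)" for i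
    by (intro fin_dim_mult_space fin_dim_span K(1) uW)
  have ZU: "?Z i \<subseteq> U" if "i < n" for i
  proof (rule mult_space_minimal[OF U])
    fix k y assume "k \<in> span K" "y \<in> (*) (u i) ` W"
    moreover have "y \<in> U" using calculation u[OF that] W(2) by auto
    ultimately show "k * y \<in> U"
      using K(2) by (intro mult_mem_span[OF U, of K "{y}" k y]) (auto intro: span_base)
  qed
  \<comment> \<open>For \<open>w\<close> in \<open>W\<close>, the product
    \<open>b i * k * u i * w\<close> equals \<open>b i * (k * (u i * w))\<close>, so these
    generators of \<open>?V\<close> reach every \<open>b i * ?Z i\<close>.\<close>
  have "span (\<Union>i<n. (*) (b i) ` ?Z i) \<subseteq> mult_space scale ?V W"
  proof (rule span_minimal[OF _ subspace_mult_space], safe)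
    fix i z assume i: "i < n" and "z \<in> ?Z i"
    moreover have "?Z i \<subseteq> {z. b i * z \<in> mult_space scale ?V W}"
    proof (rule mult_space_minimal)
      show "subspace {z. b i * z \<in> mult_space scale ?V W}"
        using subspace_mult_space[of ?V W]
        by (auto simp: subspace_def distrib_left scale_mult_right[symmetric])
      fix k y assume k: "k \<in> span K" and "y \<in> (*) (u i) ` W"
      then obtain w where w: "w \<in> W" "y = u i * w" by blast
      have "k * y \<in> {z. b i * z \<in> mult_space scale ?V W}"
      proof (rule mult_mem_span[OF _ _ k])
        show "subspace {z. b i * z \<in> mult_space scale ?V W}" by fact
        show "y \<in> span {y}" by (simp add: span_base)
        fix f h assume fh: "f \<in> K" "h \<in> {y}"
        hence "b i * f * u i \<in> ?V" using i by (intro span_base) blast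
        from mult_in_mult_space[OF this w(1)]
        show "f * h \<in> {z. b i * z \<in> mult_space scale ?V W}"
          using fh w(2) by (simp add: mult.assoc)
      qed
      thus "k * y \<in> {z. b i * z \<in> mult_space scale ?V W}" .
    qed
    ultimately show "b i * z \<in> mult_space scale ?V W" by blast
  qed
  hence "dim (span (\<Union>i<n. (*) (b i) ` ?Z i)) \<le> dim (mult_space scale ?V W)"
    using fin_dim_mono(2)[OF fin_dim_mult_space[OF V W(1)]] subspace_span by blast
  hence 1: "(\<Sum>i<n. dim (?Z i)) \<le> dim (mult_space scale ?V W)"
    using dim_UN_images_eq[of n ?Z U b] Z ZU U subspace_0[OF U] indep by simp
  have "W \<inter> {w. \<forall>i<n. u i * w = 0} = {0}"
    using inj W(2) subspace_0[OF fin_dim_subspace[OF W(1)]] by auto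
  hence "dim W \<le> (\<Sum>i<n. dim ((*) (u i) ` W))"
    using dim_le_sum_dim_images[OF W(1), of u n] fin_dim_zero by simp
  hence "growth d c (dim W) \<le> growth d c (\<Sum>i<n. dim ((*) (u i) ` W))"
    by (rule growth_mono[OF pos])
  also have "\<dots> \<le> (\<Sum>i<n. growth d c (dim ((*) (u i) ` W)))"
    by (rule growth_sum[OF pos(1,2)])
  also have "\<dots> \<le> (\<Sum>i<n. real (dim (?Z i)))"
    using uW u W(2) by (intro sum_mono gr) auto
  also have "\<dots> \<le> real (dim (mult_space scale ?V W))"
    using 1 unfolding of_nat_sum[symmetric] of_nat_le_iff .
  finally show "growth d c (dim W) \<le> real (dim (mult_space scale ?V W))" .
qed

lemma vdi_mono_const:
  assumes "vdi d c S V" "c' \<le> c" shows "vdi d c' S V"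
  using assms growth_mono_const[OF assms(2)] unfolding vdi_def by (meson order_trans)

lemma mult_space_assoc:
  "mult_space scale (mult_space scale X Y) Z = mult_space scale X (mult_space scale Y Z)"
proof
  show "mult_space scale (mult_space scale X Y) Z \<subseteq> mult_space scale X (mult_space scale Y Z)"
  proof (rule mult_space_minimal[OF subspace_mult_space])
    fix v w assume v: "v \<in> mult_space scale X Y" and w: "w \<in> Z"
    show "v * w \<in> mult_space scale X (mult_space scale Y Z)"
    proof (rule mult_mem_span[OF subspace_mult_space _ v[unfolded mult_space_def]])
      show "w \<in> span {w}" by (simp add: span_base)
      fix f h assume "f \<in> {v * w | v w. v \<in> X \<and> w \<in> Y}" "h \<in> {w}"
      then obtain x y where "x \<in> X" "y \<in> Y" "f * h = x * (y * w)" by (auto simp: mult.assoc)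
      thus "f * h \<in> mult_space scale X (mult_space scale Y Z)"
        using w by (simp add: mult_in_mult_space)
    qed
  qed
  show "mult_space scale X (mult_space scale Y Z) \<subseteq> mult_space scale (mult_space scale X Y) Z"
  proof (rule mult_space_minimal[OF subspace_mult_space])
    fix v w assume v: "v \<in> X" and w: "w \<in> mult_space scale Y Z"
    show "v * w \<in> mult_space scale (mult_space scale X Y) Z"
    proof (rule mult_mem_span[OF subspace_mult_space _ _ w[unfolded mult_space_def]])
      show "v \<in> span {v}" by (simp add: span_base)
      fix f h assume "f \<in> {v}" "h \<in> {v * w | v w. v \<in> Y \<and> w \<in> Z}"
      then obtain y z where "y \<in> Y" "z \<in> Z" "f * h = (v * y) * z" by (auto simp: mult.assoc)
      thus "f * h \<in> mult_space scale (mult_space scale X Y) Z"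
        using v by (simp add: mult_in_mult_space)
    qed
  qed
qed

lemma mult_space_one:
  assumes "subspace V"
  shows "mult_space scale (span {1}) V = V" "mult_space scale V (span {1}) = V"
proof -
  have sp: "span V = V" using assms by simp
  have "mult_space scale (span {1}) (span V) = V" "mult_space scale (span V) (span {1}) = V"
    unfolding mult_space_span by (simp_all add: sp)
  thus "mult_space scale (span {1}) V = V" "mult_space scale V (span {1}) = V"
    by (simp_all add: sp)
qed

text \<open>\<open>power_space\<close> multiplies by \<open>V\<close> on the right, whereas
  \<open>vdi\<close> multiplies on the left.\<close>

lemma power_space_commute:
  assumes "subspace V"
  shows "mult_space scale V (power_space scale V m) = power_space scale V (Suc m)"
proof (induction m)
  case 0
  show ?case using mult_space_one[OF assms] by simp
next
  case (Suc m)
  thus ?case by (simp add: mult_space_assoc[symmetric])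
qed

lemma fd_subspace_power_space:
  assumes V: "subframe scale S V" and S: "subspace S" "1 \<in> S" "\<And>a b. a \<in> S \<Longrightarrow> b \<in> S \<Longrightarrow> a * b \<in> S"
  shows "fd_subspace scale S (power_space scale V m)" "1 \<in> power_space scale V m"
proof (induction m)
  case 0
  case 1
  show ?case using fin_dim_span[of "{1}"] span_minimal[OF _ S(1), of "{1}"] S(2)
    by (simp add: fd_subspace_iff)
  case 2
  show ?case by (simp add: span_base)
next
  case (Suc m)
  have VV: "fin_dim V" "V \<subseteq> S" "1 \<in> V" using V by (auto simp: subframe_def fd_subspace_iff)
  have IH: "fin_dim (power_space scale V m)" "power_space scale V m \<subseteq> S"
    using Suc.IH(1) by (auto simp: fd_subspace_iff)
  have "mult_space scale (power_space scale V m) V \<subseteq> S"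
    using IH(2) VV(2) S(3) by (intro mult_space_minimal[OF S(1)]) blast
  moreover have "fin_dim (mult_space scale (power_space scale V m) V)"
    using IH(1) VV(1) by (rule fin_dim_mult_space)
  moreover case 1
  ultimately show ?case by (simp add: fd_subspace_iff)
  case 2
  show ?case using mult_in_mult_space[OF Suc.IH(2) VV(3)] by simp
qed

end

section \<open>Comparison with Gelfand-Kirillov dimension\<close>

text \<open>A Bernoulli bound for all \<open>s > 0\<close>; for \<open>s < 1\<close> the full slope
  \<open>s\<close> would be too large. The half comes from \<open>t / (1 + t) \<ge> t / 2\<close> on
  the unit interval.\<close>

lemma powr_one_plus_ge:
  fixes t s :: real
  assumes "0 \<le> t" "t \<le> 1" "0 < s"
  shows "1 + s * t / 2 \<le> (1 + t) powr s"
proof -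
  have "t / 2 \<le> t / (1 + t)" using assms by (intro divide_left_mono) auto
  also have "t / (1 + t) = 1 - inverse (1 + t)" using assms by (simp add: field_simps)
  also have "\<dots> \<le> ln (1 + t)"
    using ln_le_minus_one[of "inverse (1 + t)"] assms by (simp add: ln_inverse)
  finally have "s * (t / 2) \<le> s * ln (1 + t)" using assms by (intro mult_left_mono) auto
  hence "1 + s * t / 2 \<le> 1 + s * ln (1 + t)" by (simp only: times_divide_eq_right add_le_cancel_left)
  also have "\<dots> \<le> exp (s * ln (1 + t))" by (rule exp_ge_add_one_self)
  finally show ?thesis using assms by (simp add: powr_def)
qed

text \<open>With \<open>b\<^sub>m = a\<^sub>m\<^bsup>1/d\<^esup>\<close> the hypothesis becomes \<open>b\<^sub>m\<^sub>+\<^sub>1 \<ge> b\<^sub>m (1 + c/b\<^sub>m)\<^bsup>1/d\<^esup>\<close>, so \<open>b\<close> grows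
  at least linearly.\<close>
lemma growth_recursion_lower_bound:
  fixes a :: "nat \<Rightarrow> nat" and c d :: real
  assumes d: "0 < d" and c: "0 < c" "c \<le> 1" and a0: "\<And>m. 1 \<le> a m"
    and rec: "\<And>m. growth d c (a m) \<le> real (a (Suc m))"
  shows "(c / (2 * d) * real m) powr d \<le> real (a m)"
proof -
  define b where "b m = real (a m) powr (1 / d)" for m
  have apos: "0 < real (a m)" for m using a0[of m] by simp
  have ab: "real (a m) = b m powr d" for m
    using d apos[of m] by (simp add: b_def powr_powr)
  have b1: "1 \<le> b m" for m
    unfolding b_def using a0[of m] d by (intro ge_one_powr_ge_zero) auto
  have step: "b m + c / (2 * d) \<le> b (Suc m)" for m
  proof -
    define t where "t = c / b m"
    have t: "0 \<le> t" "t \<le> 1" using c b1[of m] by (auto simp: t_def divide_le_eq)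
    have "real (a m) powr ((d - 1) / d) = real (a m) * real (a m) powr (- (1 / d))"
      using powr_mult_base[of "real (a m)" "- (1 / d)"] d apos[of m] by (simp add: diff_divide_distrib)
    also have "\<dots> = real (a m) / b m" by (simp add: b_def powr_minus divide_inverse)
    finally have "growth d c (a m) = real (a m) * (1 + t)"
      by (simp add: growth_def t_def distrib_left)
    hence "real (a m) * (1 + t) \<le> real (a (Suc m))" using rec[of m] by simp
    hence "(real (a m) * (1 + t)) powr (1 / d) \<le> b (Suc m)"
      unfolding b_def using d t by (intro powr_mono2) auto
    also have "(real (a m) * (1 + t)) powr (1 / d) = b m * (1 + t) powr (1 / d)"
      unfolding b_def using t by (intro powr_mult) 
    finally have "b m * (1 + t) powr (1 / d) \<le> b (Suc m)" .
    moreover have "b m * (1 + 1 / d * t / 2) \<le> b m * (1 + t) powr (1 / d)"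
      using b1[of m] d t by (intro mult_left_mono powr_one_plus_ge) auto
    moreover have "b m * (1 + 1 / d * t / 2) = b m + c / (2 * d)"
      using b1[of m] by (simp add: t_def field_simps)
    ultimately show ?thesis by simp
  qed
  have "c / (2 * d) * real m \<le> b m"
  proof (induction m)
    case 0
    show ?case using b1[of 0] by simp
  next
    case (Suc m)
    thus ?case using step[of m] by (simp add: distrib_left)
  qed
  thus ?thesis unfolding ab using c d by (intro powr_mono2) auto
qed

lemma limsup_ln_ratio_ge:
  fixes a :: "nat \<Rightarrow> nat" and k d :: real
  assumes k: "0 < k" and d: "0 < d" and a: "\<And>m. (k * real m) powr d \<le> real (a m)"
  shows "ereal d \<le> limsup (\<lambda>m. ereal (ln (real (a m)) / ln (real m)))"
proof -
  have "(\<lambda>m. d * (ln k / ln (real m)) + d) \<longlonglongrightarrow> d * 0 + d"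
    by (intro tendsto_intros real_tendsto_divide_at_top[OF tendsto_const]
        filterlim_compose[OF ln_at_top filterlim_real_sequentially])
  hence lim: "(\<lambda>m. ereal (d * (ln k / ln (real m)) + d)) \<longlonglongrightarrow> ereal d" by simp
  have ev: "eventually (\<lambda>m. ereal (d * (ln k / ln (real m)) + d)
      \<le> ereal (ln (real (a m)) / ln (real m))) sequentially"
    using eventually_gt_at_top[of 1]
  proof eventually_elim
    case (elim m)
    have lm: "0 < ln (real m)" using elim by simp
    have "d * (ln k + ln (real m)) = ln ((k * real m) powr d)"
      using elim k by (simp add: ln_powr ln_mult)
    also have "\<dots> \<le> ln (real (a m))"
      using a[of m] elim k by (intro ln_mono) auto
    finally have "d * (ln k + ln (real m)) / ln (real m) \<le> ln (real (a m)) / ln (real m)"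
      using lm by (intro divide_right_mono) auto
    moreover have "d * (ln k + ln (real m)) / ln (real m) = d * (ln k / ln (real m)) + d"
      using lm by (simp add: field_simps)
    ultimately show ?case by simp
  qed
  have "ereal d = limsup (\<lambda>m. ereal (d * (ln k / ln (real m)) + d))"
    using lim_imp_Limsup[OF sequentially_bot lim] by simp
  also have "\<dots> \<le> limsup (\<lambda>m. ereal (ln (real (a m)) / ln (real m)))"
    using ev by (rule Limsup_mono)
  finally show ?thesis .
qed

context k_algebra
begin

lemma LD_le_GK_dim:
  assumes S: "subspace S" "1 \<in> S" "\<And>a b. a \<in> S \<Longrightarrow> b \<in> S \<Longrightarrow> a * b \<in> S" and ne: "(1 :: 'a) \<noteq> 0"
  shows "LD scale S \<le> GK_dim scale S"
proof -
  let ?l = "\<lambda>V. limsup (\<lambda>m. ereal (ln (real (dim (power_space scale V m))) / ln (real m)))"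
  have "subframe scale S (span {1})"
    using fin_dim_span[of "{1}"] span_minimal[OF _ S(1), of "{1}"] S(2)
    by (simp add: subframe_def fd_subspace_iff span_base)
  moreover have "0 \<le> ?l V" for V
  proof -
    have "0 \<le> ln (real n)" for n :: nat by (cases n) auto
    hence "0 \<le> ln (real (dim (power_space scale V m))) / ln (real m)" for m
      by (intro divide_nonneg_nonneg)
    hence "limsup (\<lambda>m::nat. 0 :: ereal) \<le> ?l V"
      by (intro Limsup_mono always_eventually allI) simp
    thus ?thesis by (simp add: Limsup_const)
  qed
  ultimately have nonneg: "0 \<le> GK_dim scale S"
    unfolding GK_dim_def by (intro SUP_upper2[of "span {1}"]) auto
  have "ereal d \<le> GK_dim scale S" if V: "subframe scale S V" and d: "0 < d" "0 < c" "vdi d c S V" for V d c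
  proof -
    \<comment> \<open>The cap at 1 keeps the quotient \<open>c / b m\<close> in the recursion at
      most 1, since \<open>b m\<close> is at least 1.\<close>
    define c' where "c' = min c 1"
    have vdi: "vdi d c' S V" using vdi_mono_const[OF d(3)] by (simp add: c'_def)
    note ps = fd_subspace_power_space[OF V S]
    have sV: "subspace V" using V by (simp add: subframe_def fd_subspace_iff fin_dim_subspace)
    have "growth d c' (dim (power_space scale V m)) \<le> real (dim (power_space scale V (Suc m)))" for m
      using vdiD[OF vdi] ps(1)[of m] unfolding power_space_commute[OF sV, symmetric]
      by (simp only: fd_subspace_iff)
    moreover have "power_space scale V m \<noteq> {0}" for m using ps(2)[of m] ne by auto
    hence "1 \<le> dim (power_space scale V m)" for m
      using dim_pos[of "power_space scale V m"] ps(1)[of m] by (simp add: fd_subspace_iff Suc_le_eq)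
    ultimately have "(c' / (2 * d) * real m) powr d \<le> real (dim (power_space scale V m))" for m
      using d by (intro growth_recursion_lower_bound) (auto simp: c'_def)
    hence "ereal d \<le> ?l V"
      using d by (intro limsup_ln_ratio_ge[of "c' / (2 * d)"]) (auto simp: c'_def)
    thus ?thesis unfolding GK_dim_def using V by (intro SUP_upper2[of V]) auto
  qed
  thus ?thesis unfolding LD_eq using nonneg by (auto intro!: SUP_least)
qed

lemma GK_dim_mono: "S \<subseteq> T \<Longrightarrow> GK_dim scale S \<le> GK_dim scale T"
  unfolding GK_dim_def subframe_def fd_subspace_iff by (intro SUP_subset_mono) auto

lemma LD_stable_subalgebra:
  assumes "subspace S" "1 \<in> S" "\<And>a b. a \<in> S \<Longrightarrow> b \<in> S \<Longrightarrow> a * b \<in> S" "(1 :: 'a) \<noteq> 0"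
    and "LD scale UNIV = LD scale S" "LD_stable scale UNIV"
  shows "LD_stable scale S"
  using LD_le_GK_dim[OF assms(1-4)] GK_dim_mono[of S UNIV] assms(5,6)
  unfolding LD_stable_def by simp

end

section \<open>Prime Goldie rings\<close>

text \<open>Dependent choice for sequences built one term at a time. As \<open>Q n\<close> sees only
  the first \<open>n\<close> terms, the diagonal of the finite stages satisfies every
  \<open>Q n\<close>. It turns the failure of a finite family to be maximal into an infinite
  independent family.\<close>

lemma infinite_extension:
  fixes Q :: "nat \<Rightarrow> (nat \<Rightarrow> 'b) \<Rightarrow> bool"
  assumes cong: "\<And>n f g. Q n f \<Longrightarrow> (\<And>i. i < n \<Longrightarrow> f i = g i) \<Longrightarrow> Q n g"
    and base: "Q 0 f0" and step: "\<And>n f. Q n f \<Longrightarrow> \<exists>x. Q (Suc n) (f(n := x))"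
  shows "\<exists>f. \<forall>n. Q n f"
proof -
  have "\<exists>F. \<forall>n. Q n (F n) \<and> (\<exists>x. F (Suc n) = (F n)(n := x))"
  proof (rule dependent_nat_choice)
    show "\<exists>f. Q 0 f" using base by blast
    show "\<exists>g. Q (Suc n) g \<and> (\<exists>x. g = f(n := x))" if "Q n f" for n f
      using step[OF that] by blast
  qed
  then obtain F where F: "\<And>n. Q n (F n)" "\<And>n. \<exists>x. F (Suc n) = (F n)(n := x)" by blast
  have stable: "F (i + Suc k) i = F (Suc i) i" for i k
  proof (induction k)
    case (Suc k)
    obtain x where "F (Suc (i + Suc k)) = (F (i + Suc k))(i + Suc k := x)" using F(2) by blast
    thus ?case using Suc by simp
  qed simp
  have "Q n (\<lambda>i. F (Suc i) i)" for n
  proof (rule cong[OF F(1)])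
    fix i assume "i < n"
    then obtain k where "n = i + Suc k" using less_iff_Suc_add by auto
    thus "F n i = F (Suc i) i" using stable by simp
  qed
  thus ?thesis by blast
qed

definition unital_subring :: "'a::ring_1 set \<Rightarrow> bool" where
  "unital_subring S \<longleftrightarrow> 1 \<in> S \<and> (\<forall>a\<in>S. \<forall>b\<in>S. a + b \<in> S) \<and> (\<forall>a\<in>S. - a \<in> S) \<and>
     (\<forall>a\<in>S. \<forall>b\<in>S. a * b \<in> S)"

lemma unital_subringD:
  assumes "unital_subring S"
  shows "1 \<in> S" "a \<in> S \<Longrightarrow> b \<in> S \<Longrightarrow> a + b \<in> S" "a \<in> S \<Longrightarrow> - a \<in> S"
    "a \<in> S \<Longrightarrow> b \<in> S \<Longrightarrow> a * b \<in> S" "0 \<in> S"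
proof -
  have "1 + - 1 \<in> S" using assms unfolding unital_subring_def by blast
  thus "0 \<in> S" by simp
qed (use assms in \<open>auto simp: unital_subring_def\<close>)

lemma unital_subring_UNIV: "unital_subring UNIV"
  by (simp add: unital_subring_def)

lemma right_ideal_onD:
  assumes "right_ideal_on S I"
  shows "x \<in> I \<Longrightarrow> x \<in> S" "0 \<in> I" "x \<in> I \<Longrightarrow> y \<in> I \<Longrightarrow> x + y \<in> I" "x \<in> I \<Longrightarrow> - x \<in> I"
    "x \<in> I \<Longrightarrow> r \<in> S \<Longrightarrow> x * r \<in> I" "x \<in> I \<Longrightarrow> y \<in> I \<Longrightarrow> x - y \<in> I"
proof -
  show "x - y \<in> I" if "x \<in> I" "y \<in> I"
  proof -
    have "x + - y \<in> I" using assms that unfolding right_ideal_on_def by blast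
    thus ?thesis by simp
  qed
qed (use assms in \<open>auto simp: right_ideal_on_def\<close>)

lemma right_ideal_on_sum:
  assumes "right_ideal_on S I" "\<And>i. i \<in> K \<Longrightarrow> f i \<in> I"
  shows "sum f K \<in> I"
  using assms(2) by (induction K rule: infinite_finite_induct)
    (auto intro: right_ideal_onD[OF assms(1)])

lemma right_ideal_on_principal:
  assumes "unital_subring S" "a \<in> S"
  shows "right_ideal_on S {a * r | r. r \<in> S}"
  unfolding right_ideal_on_def
proof (intro conjI ballI)
  note S = unital_subringD[OF assms(1)]
  show "{a * r |r. r \<in> S} \<subseteq> S" using assms(2) S(4) by blast
  show "0 \<in> {a * r |r. r \<in> S}" using S(5) by force
  fix x assume "x \<in> {a * r |r. r \<in> S}"
  then obtain r where r: "r \<in> S" "x = a * r" by blast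
  show "- x \<in> {a * r |r. r \<in> S}" using S(3)[OF r(1)] r(2) by force
  show "x * t \<in> {a * r |r. r \<in> S}" if "t \<in> S" for t
    using S(4)[OF r(1) that] r(2) by (auto simp: mult.assoc)
  fix y assume "y \<in> {a * r |r. r \<in> S}"
  then obtain r' where r': "r' \<in> S" "y = a * r'" by blast
  show "x + y \<in> {a * r |r. r \<in> S}" using S(2)[OF r(1) r'(1)] r r' distrib_left[of a r r'] by force
qed

text \<open>The principal right ideals \<open>f n S\<close> would form an infinite direct sum; this
  is the elementwise form in which the Goldie condition is contradicted below.\<close>

lemma goldie_no_independent_sequence:
  fixes f :: "nat \<Rightarrow> 'a::ring_1"
  assumes "goldie_on S" "unital_subring S" "\<And>n. f n \<in> S" "\<And>n. f n \<noteq> 0"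
    and indep: "\<And>n r s. r \<in> S \<Longrightarrow> (\<And>i. s i \<in> S) \<Longrightarrow> f n * r = (\<Sum>i<n. f i * s i) \<Longrightarrow> f n * r = 0"
  shows False
proof -
  note S = unital_subringD[OF assms(2)]
  define I where "I n = {f n * r | r. r \<in> S}" for n
  have "right_ideal_on S (I n)" for n
    unfolding I_def using assms by (intro right_ideal_on_principal)
  moreover have "I n \<noteq> {0}" for n
  proof -
    have "f n * 1 \<in> I n" using S(1) unfolding I_def by blast
    thus ?thesis using assms(4)[of n] by auto
  qed
  moreover have "I n \<inter> finsum_sets I n = {0}" for n
  proof -
    have "x = 0" if x: "x \<in> I n" "x \<in> finsum_sets I n" for x
    proof -
      obtain r where r: "r \<in> S" "x = f n * r" using x by (auto simp: I_def)
      obtain y where y: "x = (\<Sum>m<n. y m)" "\<forall>m<n. y m \<in> I m"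
        using x by (auto simp: finsum_sets_def)
      have "\<exists>s. s \<in> S \<and> (m < n \<longrightarrow> y m = f m * s)" for m
        using y(2) S(1) by (cases "m < n") (auto simp: I_def)
      then obtain s where s: "\<And>m. s m \<in> S" "\<And>m. m < n \<Longrightarrow> y m = f m * s m" by metis
      have "f n * r = (\<Sum>i<n. f i * s i)" using r y s by simp
      thus "x = 0" using indep[OF r(1) s(1)] r by simp
    qed
    moreover have "0 \<in> I n" unfolding I_def using S(5) by force
    moreover have "0 \<in> finsum_sets I n"
      unfolding finsum_sets_def I_def using S(5) by (force intro!: exI[of _ "\<lambda>_. 0"])
    ultimately show ?thesis by blast
  qed
  ultimately show False using assms(1) unfolding goldie_on_def by blast
qed

text \<open>The singular ideal vanishes: an element of it with maximal right annihilator satisfies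
  \<open>a x a = 0\<close> for all \<open>x\<close>.\<close>
lemma prime_goldie_nonsingular:
  assumes "prime_on S" "goldie_on S" "unital_subring S" "a \<in> S"
    and "\<And>b. b \<in> S \<Longrightarrow> b \<noteq> 0 \<Longrightarrow> \<exists>r\<in>S. b * r \<noteq> 0 \<and> a * (b * r) = 0"
  shows "a = 0"
proof (rule ccontr)
  assume "a \<noteq> 0"
  note S = unital_subringD[OF assms(3)]
  define Z where "Z = {a \<in> S. \<forall>b\<in>S. b \<noteq> 0 \<longrightarrow> (\<exists>r\<in>S. b * r \<noteq> 0 \<and> a * (b * r) = 0)}"
  have aZ: "a \<in> Z" using assms(4,5) by (auto simp: Z_def)
  have ZS: "a \<in> S" if "a \<in> Z" for a using that by (simp add: Z_def)
  have Zr: "a * x \<in> Z" if a: "a \<in> Z" and x: "x \<in> S" for a x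
    unfolding Z_def
  proof (intro CollectI conjI ballI impI)
    show "a * x \<in> S" using S(4) ZS a x by blast
    fix b assume b: "b \<in> S" "b \<noteq> 0"
    show "\<exists>r\<in>S. b * r \<noteq> 0 \<and> a * x * (b * r) = 0"
    proof (cases "x * b = 0")
      case True
      thus ?thesis using b S(1) by (auto simp: mult.assoc intro!: bexI[of _ 1])
    next
      case False
      then obtain r where "r \<in> S" "x * b * r \<noteq> 0" "a * (x * b * r) = 0"
        using a S(4)[OF x b(1)] unfolding Z_def by blast
      thus ?thesis by (intro bexI[of _ r]) (auto simp: mult.assoc)
    qed
  qed
  let ?R = "\<lambda>a. right_ann_on S {a}"
  have "\<exists>a\<in>Z. a \<noteq> 0 \<and> (\<forall>c\<in>Z. c \<noteq> 0 \<longrightarrow> \<not> ?R a \<subset> ?R c)"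
  proof (rule ccontr)
    assume "\<not> ?thesis"
    hence "\<And>a. a \<in> Z \<and> a \<noteq> 0 \<Longrightarrow> \<exists>c. (c \<in> Z \<and> c \<noteq> 0) \<and> ?R a \<subset> ?R c" by blast
    then obtain F where F: "\<And>n::nat. F n \<in> Z \<and> F n \<noteq> 0" "\<And>n. ?R (F n) \<subset> ?R (F (Suc n))"
      using dependent_nat_choice[of "\<lambda>_ a. a \<in> Z \<and> a \<noteq> 0" "\<lambda>_ a c. ?R a \<subset> ?R c"] aZ \<open>a \<noteq> 0\<close>
      by metis
    hence "(\<forall>n. {F n} \<subseteq> S) \<and> (\<forall>n. ?R (F n) \<subset> ?R (F (Suc n)))" using ZS by blast
    hence "\<exists>X. (\<forall>n::nat. X n \<subseteq> S) \<and> (\<forall>n. right_ann_on S (X n) \<subset> right_ann_on S (X (Suc n)))"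
      by (rule exI[of _ "\<lambda>n. {F n}"])
    thus False using assms(2) unfolding goldie_on_def by blast
  qed
  then obtain a where a: "a \<in> Z" "a \<noteq> 0" and max: "\<And>c. c \<in> Z \<Longrightarrow> c \<noteq> 0 \<Longrightarrow> \<not> ?R a \<subset> ?R c"
    by blast
  have "a * x * a = 0" if x: "x \<in> S" for x
  proof (rule ccontr)
    assume ne: "a * x * a \<noteq> 0"
    \<comment> \<open>The annihilator of \<open>a * x\<close> meets the right ideal generated by
      \<open>a\<close>, which yields an \<open>r\<close> killing \<open>a * x * a\<close> but not
      \<open>a\<close>, against maximality.\<close>
    have "a * x \<in> Z" using Zr a x by blast
    then obtain r where r: "r \<in> S" "a * r \<noteq> 0" "a * x * (a * r) = 0"
      using a ZS unfolding Z_def by blast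
    have "a * (x * a) \<in> Z" using Zr a x S(4) ZS by blast
    hence "\<not> ?R a \<subset> ?R (a * x * a)" using max ne by (simp add: mult.assoc)
    moreover have "?R a \<subseteq> ?R (a * x * a)" by (auto simp: right_ann_on_def mult.assoc)
    moreover have "r \<in> ?R (a * x * a)" "r \<notin> ?R a" using r by (auto simp: right_ann_on_def mult.assoc)
    ultimately show False by blast
  qed
  thus False using assms(1) a ZS unfolding prime_on_def by blast
qed

text \<open>Elementwise form of a uniform right ideal: it is nonzero and any two nonzero right
  ideals inside it intersect nontrivially.\<close>

definition uniform_on :: "'a::ring_1 set \<Rightarrow> 'a set \<Rightarrow> bool" where
  "uniform_on S U \<longleftrightarrow> right_ideal_on S U \<and> U \<noteq> {0} \<and>
     (\<forall>x\<in>U. \<forall>y\<in>U. x \<noteq> 0 \<longrightarrow> y \<noteq> 0 \<longrightarrow> (\<exists>r\<in>S. \<exists>s\<in>S. x * r = y * s \<and> x * r \<noteq> 0))"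

text \<open>If nothing is uniform, every nonzero \<open>v S\<close> contains two independent
  principal right ideals. Starting from \<open>v = 1\<close>, one of them is recorded in
  \<open>f\<close> and the other is split again, producing an infinite direct sum.\<close>

lemma goldie_uniform_exists:
  assumes "goldie_on S" "unital_subring S" "(1 :: 'a::ring_1) \<noteq> 0"
  shows "\<exists>U :: 'a set. uniform_on S U"
proof (rule ccontr)
  assume no: "\<nexists>U :: 'a set. uniform_on S U"
  note S = unital_subringD[OF assms(2)]
  have split: "\<exists>x y. x \<in> S \<and> y \<in> S \<and> v * x \<noteq> 0 \<and> v * y \<noteq> 0 \<and>
      (\<forall>r\<in>S. \<forall>s\<in>S. v * x * r = v * y * s \<longrightarrow> v * x * r = 0)" if v: "v \<in> S" "v \<noteq> 0" for v
  proof -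
    let ?U = "{v * r | r. r \<in> S}"
    have "v * 1 \<in> ?U" using S(1) by blast
    hence "?U \<noteq> {0}" using v(2) by auto
    moreover have "\<not> uniform_on S ?U" using no by blast
    ultimately have "\<not> (\<forall>x\<in>?U. \<forall>y\<in>?U. x \<noteq> 0 \<longrightarrow> y \<noteq> 0 \<longrightarrow>
        (\<exists>r\<in>S. \<exists>s\<in>S. x * r = y * s \<and> x * r \<noteq> 0))"
      using right_ideal_on_principal[OF assms(2) v(1)] unfolding uniform_on_def by simp
    then obtain x' y' where xy: "x' \<in> ?U" "y' \<in> ?U" "x' \<noteq> 0" "y' \<noteq> 0"
      "\<not> (\<exists>r\<in>S. \<exists>s\<in>S. x' * r = y' * s \<and> x' * r \<noteq> 0)"
      by (simp only: not_all not_imp ball_simps bex_simps Ball_def) blast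
    obtain x y where "x \<in> S" "x' = v * x" "y \<in> S" "y' = v * y" using xy(1,2) by blast
    thus ?thesis using xy(3-5) by blast
  qed
  text \<open>\<open>f\<^sub>0, \<dots>, f\<^sub>n\<^sub>-\<^sub>1\<close> are independent and \<open>v S\<close> is independent of them.\<close>
  define Q where "Q n f \<longleftrightarrow> (\<forall>i<n. f i \<in> S \<and> f i \<noteq> 0 \<and>
      (\<forall>r\<in>S. \<forall>s. (\<forall>j. s j \<in> S) \<longrightarrow> f i * r = (\<Sum>j<i. f j * s j) \<longrightarrow> f i * r = 0)) \<and>
      (\<exists>v\<in>S. v \<noteq> 0 \<and> (\<forall>r\<in>S. \<forall>s. (\<forall>j. s j \<in> S) \<longrightarrow> v * r = (\<Sum>j<n. f j * s j) \<longrightarrow> v * r = 0))"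
    for n and f :: "nat \<Rightarrow> 'a"
  have "\<exists>f. \<forall>n. Q n f"
  proof (rule infinite_extension)
    show "Q 0 (\<lambda>_. 0)" unfolding Q_def using S(1) assms(3) by (auto intro!: bexI[of _ 1])
    show "Q n g" if Q: "Q n f" and eq: "\<And>i. i < n \<Longrightarrow> f i = g i" for n f g
    proof -
      have "(\<Sum>j<i. f j * s j) = (\<Sum>j<i. g j * s j)" if "i \<le> n" for i s
        using that eq by (intro sum.cong) auto
      thus ?thesis using Q eq unfolding Q_def by auto
    qed
    fix n f assume Q: "Q n f"
    then obtain v where v: "v \<in> S" "v \<noteq> 0"
      "\<And>r s. r \<in> S \<Longrightarrow> (\<And>j. s j \<in> S) \<Longrightarrow> v * r = (\<Sum>j<n. f j * s j) \<Longrightarrow> v * r = 0"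
      unfolding Q_def by blast
    obtain x y where xy: "x \<in> S" "y \<in> S" "v * x \<noteq> 0" "v * y \<noteq> 0"
      "\<And>r s. r \<in> S \<Longrightarrow> s \<in> S \<Longrightarrow> v * x * r = v * y * s \<Longrightarrow> v * x * r = 0"
      using split[OF v(1,2)] by blast
    let ?g = "f(n := v * x)"
    have sums: "(\<Sum>j<i. ?g j * s j) = (\<Sum>j<i. f j * s j)" if "i \<le> n" for i s
      using that by (intro sum.cong) auto
    have "Q (Suc n) ?g"
      unfolding Q_def
    proof (intro conjI allI impI)
      fix i assume i: "i < Suc n"
      show "?g i \<in> S" "?g i \<noteq> 0"
        using i Q xy v(1) S(4) unfolding Q_def by (auto simp: less_Suc_eq)
      show "\<forall>r\<in>S. \<forall>s. (\<forall>j. s j \<in> S) \<longrightarrow> ?g i * r = (\<Sum>j<i. ?g j * s j) \<longrightarrow> ?g i * r = 0"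
      proof (intro ballI allI impI)
        fix r s assume rs: "r \<in> S" "\<forall>j. s j \<in> S" "?g i * r = (\<Sum>j<i. ?g j * s j)"
        show "?g i * r = 0"
        proof (cases "i = n")
          case True
          hence "v * (x * r) = (\<Sum>j<n. f j * s j)"
            using rs(3) sums[of n s] by (simp add: mult.assoc)
          thus ?thesis using v(3)[of "x * r" s] rs S(4)[OF xy(1)] True by (simp add: mult.assoc)
        next
          case False
          hence "i < n" using i by simp
          hence "f i * r = (\<Sum>j<i. f j * s j)" using rs(3) sums[of i s] by simp
          thus ?thesis using Q rs \<open>i < n\<close> unfolding Q_def by auto
        qed
      qed
    next
      show "\<exists>w\<in>S. w \<noteq> 0 \<and> (\<forall>r\<in>S. \<forall>s. (\<forall>j. s j \<in> S) \<longrightarrow>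
          w * r = (\<Sum>j<Suc n. ?g j * s j) \<longrightarrow> w * r = 0)"
      proof (intro bexI[of _ "v * y"] conjI ballI allI impI)
        show "v * y \<in> S" using v xy S(4) by blast
        show "v * y \<noteq> 0" by fact
        fix r s assume rs: "r \<in> S" "\<forall>j. s j \<in> S" "v * y * r = (\<Sum>j<Suc n. ?g j * s j)"
        have eq: "v * y * r = (\<Sum>j<n. f j * s j) + v * x * s n"
          using rs(3) sums[of n s] by simp
        \<comment> \<open>Moving the new term to the left gives an element of \<open>v S\<close> in
          the sum of the earlier \<open>f j S\<close>, hence zero. What remains relates
          \<open>v * x\<close> to \<open>v * y\<close>.\<close>
        let ?t = "y * r + - (x * s n)"
        have "?t \<in> S"
          using rs(2) by (intro S(2) S(3) S(4) xy(1,2) rs(1)) auto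
        moreover have "v * ?t = (\<Sum>j<n. f j * s j)"
          using eq by (simp add: algebra_simps)
        ultimately have "v * ?t = 0" using v(3) rs(2) by blast
        hence "v * x * s n = v * y * r" by (simp add: algebra_simps)
        thus "v * y * r = 0" using xy(5)[of "s n" r] rs by simp
      qed
    qed
    thus "\<exists>x. Q (Suc n) (f(n := x))" by blast
  qed
  then obtain f where f: "\<And>n. Q n f" by blast
  show False
  proof (rule goldie_no_independent_sequence[OF assms(1,2), of f])
    fix n
    have "n < Suc n" by simp
    thus "f n \<in> S" "f n \<noteq> 0"
      "\<And>r s. r \<in> S \<Longrightarrow> (\<And>i. s i \<in> S) \<Longrightarrow> f n * r = (\<Sum>i<n. f i * s i) \<Longrightarrow> f n * r = 0"
      using f[of "Suc n"] unfolding Q_def by blast+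
  qed
qed

section \<open>Finite groups of automorphisms\<close>

text \<open>Scalars are absent from this part: \<open>torsion_free\<close> is the form in which
  characteristic zero is used, namely to cancel the order of \<open>G\<close>.\<close>

locale ring_aut_group =
  fixes G :: "('a::ring_1 \<Rightarrow> 'a) set"
  assumes finite_G: "finite G" and id_G: "id \<in> G"
    and comp_G: "g \<in> G \<Longrightarrow> h \<in> G \<Longrightarrow> g \<circ> h \<in> G" and inv_G: "g \<in> G \<Longrightarrow> inv g \<in> G"
    and bij_G: "g \<in> G \<Longrightarrow> bij g" and one_G: "g \<in> G \<Longrightarrow> g 1 = 1"
    and add_G: "g \<in> G \<Longrightarrow> g (a + b) = g a + g b"
    and mult_G: "g \<in> G \<Longrightarrow> g (a * b) = g a * g b"
    and torsion_free: "0 < n \<Longrightarrow> of_nat n * (a :: 'a) = 0 \<Longrightarrow> a = 0"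
begin

lemma zero_G: "g \<in> G \<Longrightarrow> g 0 = 0"
  using add_G[of g 0 0] by simp

lemma minus_G: "g \<in> G \<Longrightarrow> g (- a) = - g a"
  using add_G[of g a "- a"] zero_G[of g] by (simp add: eq_neg_iff_add_eq_0 add.commute)

lemma sum_G: "g \<in> G \<Longrightarrow> g (sum f K) = (\<Sum>k\<in>K. g (f k))"
  by (induction K rule: infinite_finite_induct) (auto simp: add_G zero_G)

lemma inv_apply_G: "g \<in> G \<Longrightarrow> inv g (g a) = a" "g \<in> G \<Longrightarrow> g (inv g a) = a"
  using bij_G by (auto simp: bij_is_inj bij_is_surj surj_f_inv_f)

lemma eq_0_G: "g \<in> G \<Longrightarrow> g a = 0 \<longleftrightarrow> a = 0"
  using inv_apply_G(1)[of g a] zero_G[OF inv_G, of g] zero_G by metis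

lemma sum_reindex_G:
  assumes "h \<in> G"
  shows "(\<Sum>g\<in>G. \<phi> (h \<circ> g)) = (\<Sum>g\<in>G. \<phi> g)"
proof (rule sum.reindex_bij_betw)
  have "(\<lambda>g. h \<circ> g) ` G = G"
  proof safe
    fix g assume g: "g \<in> G"
    have "g = h \<circ> (inv h \<circ> g)" using inv_apply_G(2)[OF assms] by auto
    thus "g \<in> (\<lambda>g. h \<circ> g) ` G" using g assms comp_G inv_G by blast
  qed (use assms comp_G in blast)
  moreover have "inj_on (\<lambda>g. h \<circ> g) G"
    using bij_is_inj[OF bij_G[OF assms]] by (auto simp: inj_on_def fun_eq_iff)
  ultimately show "bij_betw (\<lambda>g. h \<circ> g) G G" by (simp add: bij_betw_def)
qed

abbreviation "B \<equiv> fixed_ring G"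
abbreviation "tr \<equiv> trace G"

lemma fixedD: "b \<in> B \<Longrightarrow> g \<in> G \<Longrightarrow> g b = b"
  by (simp add: fixed_ring_def)

lemma unital_subring_fixed: "unital_subring B"
  unfolding unital_subring_def
proof (intro conjI ballI)
  have fixedI: "b \<in> B" if "\<And>g. g \<in> G \<Longrightarrow> g b = b" for b
    using that by (simp add: fixed_ring_def)
  show "1 \<in> B" by (intro fixedI one_G)
  fix a assume a: "a \<in> B"
  show "- a \<in> B" using fixedD[OF a] by (intro fixedI) (simp add: minus_G)
  fix b assume b: "b \<in> B"
  show "a + b \<in> B"
  proof (rule fixedI)
    show "g (a + b) = a + b" if "g \<in> G" for g
      using add_G[OF that, of a b] fixedD[OF a that] fixedD[OF b that] by simp
  qed
  show "a * b \<in> B"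
  proof (rule fixedI)
    show "g (a * b) = a * b" if "g \<in> G" for g
      using mult_G[OF that, of a b] fixedD[OF a that] fixedD[OF b that] by simp
  qed
qed

lemma trace_fixed: "tr a \<in> B"
  unfolding fixed_ring_def trace_def
proof safe
  fix h assume h: "h \<in> G"
  have "h (\<Sum>g\<in>G. g a) = (\<Sum>g\<in>G. (h \<circ> g) a)" by (simp add: sum_G[OF h])
  also have "\<dots> = (\<Sum>g\<in>G. g a)" by (rule sum_reindex_G[OF h])
  finally show "h (\<Sum>g\<in>G. g a) = (\<Sum>g\<in>G. g a)" .
qed

lemma trace_add: "tr (a + b) = tr a + tr b"
  by (simp add: trace_def add_G sum.distrib)

lemma trace_mult_left:
  assumes "b \<in> B" shows "tr (b * a) = b * tr a"
  unfolding trace_def sum_distrib_left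
proof (rule sum.cong)
  show "g (b * a) = b * g a" if "g \<in> G" for g
    using mult_G[OF that, of b a] fixedD[OF assms that] by simp
qed simp

lemma trace_in_right_ideal:
  assumes "right_ideal_on UNIV I" "\<And>g x. g \<in> G \<Longrightarrow> x \<in> I \<Longrightarrow> g x \<in> I" "x \<in> I"
  shows "tr x \<in> I"
  unfolding trace_def using assms by (intro right_ideal_on_sum) auto

text \<open>Maschke's theorem for essential extensions: otherwise averaging the projection onto \<open>M\<close> along a
  maximal complement \<open>I\<close> produces an invariant right ideal that misses \<open>M\<close>.\<close>
lemma essential_of_invariant_essential:
  assumes M: "right_ideal_on UNIV M" "\<And>g x. g \<in> G \<Longrightarrow> x \<in> M \<Longrightarrow> g x \<in> M"
    and ess: "\<And>H. right_ideal_on UNIV H \<Longrightarrow> (\<And>g x. g \<in> G \<Longrightarrow> x \<in> H \<Longrightarrow> g x \<in> H) \<Longrightarrow>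
                H \<inter> M = {0} \<Longrightarrow> H = {0}"
    and H: "right_ideal_on UNIV H" "H \<inter> M = {0}"
  shows "H = {0}"
proof -
  let ?C = "{I. right_ideal_on UNIV I \<and> I \<inter> M = {0} \<and> H \<subseteq> I}"
  have "\<exists>I\<in>?C. \<forall>X\<in>?C. I \<subseteq> X \<longrightarrow> X = I"
  proof (rule subset_Zorn_nonempty)
    show "?C \<noteq> {}" using H by blast
    fix C assume C: "C \<noteq> {}" "subset.chain ?C C"
    have Cr: "right_ideal_on UNIV X" "X \<inter> M = {0}" "H \<subseteq> X" if "X \<in> C" for X
      using C(2) that unfolding subset.chain_def by auto
    have "right_ideal_on UNIV (\<Union>C)"
      unfolding right_ideal_on_def
    proof (intro conjI ballI)
      show "0 \<in> \<Union>C" using C(1) Cr(1) right_ideal_onD(2) by blast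
      fix x assume "x \<in> \<Union>C"
      then obtain X where X: "X \<in> C" "x \<in> X" by blast
      show "- x \<in> \<Union>C" "\<And>r. x * r \<in> \<Union>C"
        using right_ideal_onD(4,5)[OF Cr(1)[OF X(1)] X(2)] X(1) by blast+
      fix y assume "y \<in> \<Union>C"
      then obtain Y where Y: "Y \<in> C" "y \<in> Y" by blast
      have "X \<subseteq> Y \<or> Y \<subseteq> X" using C(2) X Y unfolding subset.chain_def by blast
      thus "x + y \<in> \<Union>C"
        using right_ideal_onD(3)[OF Cr(1)[OF X(1)] X(2), of y]
          right_ideal_onD(3)[OF Cr(1)[OF Y(1)], of x y] X Y by blast
    qed simp
    moreover have "\<Union>C \<inter> M = {0}" using C(1) Cr(2) by blast
    moreover have "H \<subseteq> \<Union>C" using C(1) Cr(3) by blast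
    ultimately show "\<Union>C \<in> ?C" by blast
  qed
  then obtain I where IC: "I \<in> ?C" and I_max: "\<forall>X\<in>?C. I \<subseteq> X \<longrightarrow> X = I" by (rule bexE)
  have I: "right_ideal_on UNIV I" "I \<inter> M = {0}" "H \<subseteq> I" using IC by simp_all
  have max: "X = I" if "right_ideal_on UNIV X" "X \<inter> M = {0}" "I \<subseteq> X" for X
  proof -
    have "X \<in> ?C" using that I(3) by simp
    thus ?thesis using I_max that(3) by simp
  qed
  note Md = right_ideal_onD[OF M(1)] and Id = right_ideal_onD[OF I(1)]
  \<comment> \<open>\<open>E\<close> is the direct sum of \<open>M\<close> and \<open>I\<close>. It
    is essential because an \<open>x\<close> whose right multiples meet \<open>E\<close> only in 0
    could be added to \<open>I\<close>.\<close>
  define E where "E = {m + i | m i. m \<in> M \<and> i \<in> I}"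
  have essE: "\<exists>r. x * r \<noteq> 0 \<and> x * r \<in> E" if x: "x \<noteq> 0" for x
  proof (rule ccontr)
    assume "\<nexists>r. x * r \<noteq> 0 \<and> x * r \<in> E"
    hence no: "x * r = 0" if "x * r \<in> E" for r using that by blast
    let ?X = "{i + x * r | i r. i \<in> I}"
    have "?X = I"
    proof (rule max)
      show "right_ideal_on UNIV ?X"
        unfolding right_ideal_on_def
      proof (intro conjI ballI)
        show "0 \<in> ?X" using Id(2) by (force intro: exI[of _ 0])
        fix y assume "y \<in> ?X"
        then obtain i r where y: "i \<in> I" "y = i + x * r" by blast
        have "- y = - i + x * (- r)" using y by simp
        thus "- y \<in> ?X" using Id(4)[OF y(1)] by blast
        show "y * s \<in> ?X" for s
        proof -
          have "y * s = i * s + x * (r * s)" using y by (simp add: algebra_simps)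
          thus ?thesis using Id(5)[OF y(1), of s] by blast
        qed
        fix z assume "z \<in> ?X"
        then obtain j s where z: "j \<in> I" "z = j + x * s" by blast
        have "y + z = (i + j) + x * (r + s)" using y z by (simp add: algebra_simps)
        thus "y + z \<in> ?X" using Id(3)[OF y(1) z(1)] by blast
      qed simp
      have "y = 0" if yX: "y \<in> ?X" and yM: "y \<in> M" for y
      proof -
        obtain i r where y: "i \<in> I" "y = i + x * r" using yX by blast
        have "x * r = y + (- i)" using y by simp
        hence "x * r \<in> E" unfolding E_def using yM Id(4)[OF y(1)] by blast
        hence "x * r = 0" by (rule no)
        thus "y = 0" using y yM I(2) by auto
      qed
      moreover have "0 \<in> ?X" using Id(2) by (force intro: exI[of _ 0])
      ultimately show "?X \<inter> M = {0}" using Md(2) by blast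
      show "I \<subseteq> ?X" by (force intro: exI[of _ 0])
    qed
    moreover have "0 + x * 1 \<in> ?X" using Id(2) by blast
    ultimately have "x \<in> I" by simp
    hence "x * 1 \<in> E" unfolding E_def using Md(2) by force
    thus False using no[of 1] x by simp
  qed
  have E_right: "y * r \<in> E" if yE: "y \<in> E" for y r
  proof -
    obtain m i where "m \<in> M" "i \<in> I" "y = m + i" using yE by (auto simp: E_def)
    moreover have "(m + i) * r = m * r + i * r" by (rule distrib_right)
    ultimately show ?thesis unfolding E_def using Md(5)[of m r] Id(5)[of i r] by blast
  qed
  define p where "p x = (SOME m. m \<in> M \<and> x - m \<in> I)" for x
  have p: "p x \<in> M \<and> x - p x \<in> I" if xE: "x \<in> E" for x
    unfolding p_def
  proof (rule someI_ex)
    obtain m i where "m \<in> M" "i \<in> I" "x = m + i" using xE by (auto simp: E_def)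
    thus "\<exists>m. m \<in> M \<and> x - m \<in> I" by (auto intro: exI[of _ m])
  qed
  have p_eq: "p x = m" if "x \<in> E" "m \<in> M" "x - m \<in> I" for x m
  proof -
    have "p x - m \<in> M" using p[OF that(1)] that(2) Md(6) by blast
    moreover have "(x - m) - (x - p x) \<in> I" using p[OF that(1)] that(3) Id(6) by blast
    moreover have "(x - m) - (x - p x) = p x - m" by simp
    ultimately have "p x - m \<in> I \<inter> M" by (simp only: Int_iff)
    thus ?thesis unfolding I(2) by simp
  qed
  have E_add: "x + y \<in> E" "p (x + y) = p x + p y" if "x \<in> E" "y \<in> E" for x y
  proof -
    have pM: "p x + p y \<in> M" using p[OF that(1)] p[OF that(2)] Md(3) by simp
    have pI: "(x - p x) + (y - p y) \<in> I" using p[OF that(1)] p[OF that(2)] Id(3) by simp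
    have "x + y = (p x + p y) + ((x - p x) + (y - p y))" by simp
    thus E: "x + y \<in> E" unfolding E_def using pM pI by blast
    have eq: "(x + y) - (p x + p y) = (x - p x) + (y - p y)" by simp
    show "p (x + y) = p x + p y" by (rule p_eq[OF E pM]) (unfold eq, rule pI)
  qed
  have p_mult: "p (x * r) = p x * r" if "x \<in> E" for x r
  proof (rule p_eq[OF E_right[OF that]])
    show "p x * r \<in> M" using p[OF that] Md(5) by blast
    have "x * r - p x * r = (x - p x) * r" by (simp add: algebra_simps)
    thus "x * r - p x * r \<in> I" using p[OF that] Id(5) by simp
  qed
  have ME: "M \<subseteq> E" unfolding E_def using Id(2) by force
  have pM: "p m = m" if "m \<in> M" for m using that ME Id(2) by (intro p_eq) auto
  \<comment> \<open>The projection \<open>p\<close> is meaningful only on \<open>E\<close>, which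
    need not be invariant. Averaging therefore takes place on the intersection \<open>D\<close> of
    the translates of \<open>E\<close>.\<close>
  define D where "D = {x. \<forall>g\<in>G. inv g x \<in> E}"
  define q where "q x = (\<Sum>g\<in>G. g (p (inv g x)))" for x
  \<comment> \<open>A finite intersection of essential right ideals is essential: multipliers moving
    \<open>x\<close> into the translates are accumulated one group element at a time.\<close>
  have essD: "\<exists>r. x * r \<noteq> 0 \<and> (\<forall>g\<in>F. inv g (x * r) \<in> E)" if "x \<noteq> 0" "finite F" "F \<subseteq> G" for x F
    using that(2,3,1)
  proof (induction F)
    case empty
    thus ?case by (auto intro: exI[of _ 1])
  next
    case (insert h F)
    then obtain r where r: "x * r \<noteq> 0" "\<And>g. g \<in> F \<Longrightarrow> inv g (x * r) \<in> E" by blast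
    have h: "h \<in> G" "inv h \<in> G" using insert.prems inv_G by auto
    have "inv h (x * r) \<noteq> 0" using r(1) eq_0_G[OF h(2)] by simp
    then obtain s where s: "inv h (x * r) * s \<noteq> 0" "inv h (x * r) * s \<in> E" using essE by blast
    have eq: "inv h (x * r * h s) = inv h (x * r) * s"
      using mult_G[OF h(2)] inv_apply_G(1)[OF h(1)] by simp
    have "x * r * h s \<noteq> 0" using s(1) eq zero_G[OF h(2)] by metis
    moreover have "inv g (x * r * h s) \<in> E" if "g \<in> F" for g
      using r(2)[OF that] E_right mult_G[OF inv_G, of g] that insert.prems by auto
    ultimately show ?case using eq s(2) by (intro exI[of _ "r * h s"]) (auto simp: mult.assoc)
  qed
  have MD: "M \<subseteq> D" unfolding D_def using M(2) inv_G ME by blast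
  have q_mem: "q x \<in> M" if "x \<in> D" for x
    unfolding q_def using that p M(2) by (intro right_ideal_on_sum[OF M(1)]) (auto simp: D_def)
  have qM: "q m = of_nat (card G) * m" if "m \<in> M" for m
  proof -
    have "g (p (inv g m)) = m" if "g \<in> G" for g
      using pM M(2)[OF inv_G[OF that] \<open>m \<in> M\<close>] inv_apply_G(2)[OF that] by simp
    hence "q m = (\<Sum>g\<in>G. m)" unfolding q_def by (rule sum.cong[OF refl])
    thus ?thesis by simp
  qed
  have D_add: "x + y \<in> D" "q (x + y) = q x + q y" if "x \<in> D" "y \<in> D" for x y
  proof -
    have E: "inv g x \<in> E" "inv g y \<in> E" if "g \<in> G" for g
      using \<open>x \<in> D\<close> \<open>y \<in> D\<close> that by (auto simp: D_def)
    have eq: "inv g (x + y) = inv g x + inv g y" if "g \<in> G" for g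
      by (rule add_G[OF inv_G[OF that]])
    show "x + y \<in> D" unfolding D_def using E E_add(1) eq by simp
    have "g (p (inv g (x + y))) = g (p (inv g x)) + g (p (inv g y))" if "g \<in> G" for g
      using E_add(2)[OF E[OF that]] eq[OF that] add_G[OF that] by simp
    thus "q (x + y) = q x + q y" unfolding q_def sum.distrib[symmetric] by (rule sum.cong[OF refl])
  qed
  have D_mult: "x * r \<in> D" "q (x * r) = q x * r" if "x \<in> D" for x r
  proof -
    have E: "inv g x \<in> E" if "g \<in> G" for g
      using \<open>x \<in> D\<close> that by (auto simp: D_def)
    have eq: "inv g (x * r) = inv g x * inv g r" if "g \<in> G" for g
      by (rule mult_G[OF inv_G[OF that]])
    show "x * r \<in> D" unfolding D_def using E E_right eq by simp
    have "g (p (inv g (x * r))) = g (p (inv g x)) * r" if "g \<in> G" for g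
      using p_mult[OF E[OF that]] eq[OF that] mult_G[OF that] inv_apply_G(2)[OF that] by simp
    thus "q (x * r) = q x * r" unfolding q_def sum_distrib_right by (rule sum.cong[OF refl])
  qed
  have D_G: "h x \<in> D" "q (h x) = h (q x)" if "x \<in> D" "h \<in> G" for h x
  proof -
    have eq: "inv g (h x) = inv (inv h \<circ> g) x" if g: "g \<in> G" for g
    proof -
      have "bij (inv h \<circ> g)" using comp_G[OF inv_G[OF \<open>h \<in> G\<close>] g] by (rule bij_G)
      moreover have "(inv h \<circ> g) (inv g (h x)) = x"
        using inv_apply_G[OF g] inv_apply_G[OF \<open>h \<in> G\<close>] by simp
      ultimately show ?thesis by (metis bij_inv_eq_iff)
    qed
    show "h x \<in> D" unfolding D_def using that eq comp_G inv_G by (auto simp: D_def)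
    have "q (h x) = (\<Sum>g\<in>G. (\<lambda>g. g (p (inv g (h x)))) (h \<circ> g))"
      unfolding q_def by (rule sum_reindex_G[OF that(2), symmetric])
    also have "\<dots> = (\<Sum>g\<in>G. h (g (p (inv g x))))"
    proof (intro sum.cong refl)
      fix g assume g: "g \<in> G"
      have "inv h \<circ> (h \<circ> g) = g" using inv_apply_G(1)[OF that(2)] by auto
      thus "(\<lambda>g. g (p (inv g (h x)))) (h \<circ> g) = h (g (p (inv g x)))"
        using eq[OF comp_G[OF that(2) g]] by simp
    qed
    also have "\<dots> = h (q x)" by (simp add: q_def sum_G[OF that(2)])
    finally show "q (h x) = h (q x)" .
  qed
  have D0: "0 \<in> D" using MD Md(2) by blast
  have D_minus: "- x \<in> D" "q (- x) = - q x" if "x \<in> D" for x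
    using D_mult[OF that, of "- 1"] by auto
  \<comment> \<open>The kernel of the averaged map is invariant and misses \<open>M\<close>, where
    \<open>q\<close> is multiplication by the group order; so the hypothesis on invariant right
    ideals applies to it.\<close>
  define K where "K = {x \<in> D. q x = 0}"
  have cG: "0 < card G" using finite_G id_G card_gt_0_iff by blast
  have "K = {0}"
  proof (rule ess)
    have q0: "q 0 = 0" using qM[OF Md(2)] by simp
    show "right_ideal_on UNIV K"
      unfolding right_ideal_on_def K_def using D0 D_add D_minus D_mult q0 by auto
    show "g x \<in> K" if "g \<in> G" "x \<in> K" for g x
      using that D_G zero_G by (auto simp: K_def)
    show "K \<inter> M = {0}"
      using qM torsion_free[OF cG] D0 q0 Md(2) by (auto simp: K_def)
  qed
  have "x = 0" if x: "x \<in> H" for x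
  proof (rule ccontr)
    assume "x \<noteq> 0"
    then obtain r where r: "x * r \<noteq> 0" "x * r \<in> D"
      using essD[OF _ finite_G subset_refl] by (auto simp: D_def)
    \<comment> \<open>Both terms of \<open>?n * ?y - q ?y\<close> have the same image under
      \<open>q\<close>, so the difference lies in \<open>K\<close> and vanishes. Then
      \<open>?n * ?y\<close> lies in \<open>I \<inter> M = {0}\<close>.\<close>
    let ?y = "x * r" and ?n = "of_nat (card G) :: 'a"
    have comm: "?n * z = z * ?n" for z by (rule mult_of_nat_commute)
    have yI: "?y \<in> I" using x I(3) Id(5) by blast
    have nyI: "?n * ?y \<in> I" unfolding comm using Id(5)[OF yI] by simp
    have nD: "?n * ?y \<in> D" "q (?n * ?y) = q ?y * ?n" unfolding comm using D_mult[OF r(2)] by auto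
    have qyM: "q ?y \<in> M" by (rule q_mem[OF r(2)])
    have "q (?n * ?y + - q ?y) = q ?y * ?n + - q (q ?y)"
      using D_add(2)[OF nD(1) D_minus(1)] D_minus(2) nD(2) MD qyM by auto
    also have "\<dots> = 0" using qM[OF qyM] comm by simp
    finally have "?n * ?y + - q ?y \<in> K"
      using D_add(1)[OF nD(1) D_minus(1)] MD qyM by (auto simp: K_def)
    hence "?n * ?y + - q ?y = 0" using \<open>K = {0}\<close> by blast
    hence "?n * ?y = q ?y" by simp
    hence "?n * ?y = 0" using nyI qyM I(2) by auto
    thus False using torsion_free[OF cG] r(1) by blast
  qed
  thus ?thesis using right_ideal_onD(2)[OF H(1)] by blast
qed

text \<open>The right ideal \<open>M\<close> of the algebra generated by the annihilator
  \<open>J\<close> of \<open>a\<close> in the fixed ring is invariant. A nonzero invariant right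
  ideal contains a nonzero trace, hence meets \<open>J\<close>; Maschke then makes \<open>M\<close>
  essential. As \<open>a\<close> kills \<open>M\<close>, it lies in the singular ideal of the
  algebra, which is zero.\<close>

lemma fixed_ring_nonsingular:
  assumes primeA: "prime_on (UNIV :: 'a set)" and goldieA: "goldie_on (UNIV :: 'a set)"
    and nondeg: "trace_nondegenerate G"
    and ess: "\<And>b. b \<in> B \<Longrightarrow> b \<noteq> 0 \<Longrightarrow> \<exists>r\<in>B. b * r \<noteq> 0 \<and> a * (b * r) = 0"
  shows "a = 0"
proof -
  define J where "J = {b \<in> B. a * b = 0}"
  define M where "M = \<Inter>{I. right_ideal_on UNIV I \<and> J \<subseteq> I}"
  have M: "right_ideal_on UNIV M"
    unfolding M_def right_ideal_on_def by auto
  have M_least: "M \<subseteq> I" if "right_ideal_on UNIV I" "J \<subseteq> I" for I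
    using that unfolding M_def by blast
  have JM: "J \<subseteq> M" unfolding M_def by blast
  have MG: "g x \<in> M" if "g \<in> G" "x \<in> M" for g x
  proof -
    have "right_ideal_on UNIV {x. g x \<in> M}"
      using right_ideal_onD[OF M] that(1)
      by (auto simp: right_ideal_on_def zero_G add_G minus_G mult_G)
    moreover have "J \<subseteq> {x. g x \<in> M}" using JM fixedD[OF _ that(1)] by (auto simp: J_def)
    ultimately show ?thesis using M_least that(2) by blast
  qed
  have aM: "a * m = 0" if "m \<in> M" for m
  proof -
    have "right_ideal_on UNIV {x. a * x = 0}"
      by (auto simp: right_ideal_on_def distrib_left mult.assoc[symmetric])
    moreover have "J \<subseteq> {x. a * x = 0}" by (auto simp: J_def)
    ultimately show ?thesis using M_least that by blast
  qed
  have essM: "H = {0}" if H: "right_ideal_on UNIV H" "H \<inter> M = {0}" for H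
  proof (rule essential_of_invariant_essential[of M H])
    show "right_ideal_on UNIV M" "right_ideal_on UNIV H" "H \<inter> M = {0}" by fact+
    show "g x \<in> M" if "g \<in> G" "x \<in> M" for g x using MG that .
    fix H assume H: "right_ideal_on UNIV H" "\<And>g x. g \<in> G \<Longrightarrow> x \<in> H \<Longrightarrow> g x \<in> H" "H \<inter> M = {0}"
    have "x = 0" if x: "x \<in> H" for x
    proof (rule ccontr)
      assume "x \<noteq> 0"
      then obtain y where y: "tr (x * y) \<noteq> 0" using nondeg unfolding trace_nondegenerate_def by blast
      obtain r where r: "r \<in> B" "tr (x * y) * r \<noteq> 0" "a * (tr (x * y) * r) = 0"
        using ess[OF trace_fixed y] by blast
      have "tr (x * y) * r \<in> J"
        using r unital_subringD(4)[OF unital_subring_fixed trace_fixed] by (auto simp: J_def)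
      moreover have "tr (x * y) * r \<in> H"
        using trace_in_right_ideal[of H "x * y"] H(1,2) right_ideal_onD(5)[OF H(1)] x by blast
      ultimately show False using H(3) JM r(2) by blast
    qed
    thus "H = {0}" using right_ideal_onD(2)[OF H(1)] by blast
  qed
  show "a = 0"
  proof (rule prime_goldie_nonsingular[OF primeA goldieA unital_subring_UNIV UNIV_I])
    fix b :: 'a assume b: "b \<noteq> 0"
    let ?H = "{b * r | r. r \<in> UNIV}"
    have H: "right_ideal_on UNIV ?H"
      by (rule right_ideal_on_principal[OF unital_subring_UNIV UNIV_I])
    have "b * 1 \<in> ?H" by blast
    hence "?H \<noteq> {0}" using b by auto
    hence "?H \<inter> M \<noteq> {0}" using essM[OF H] by blast
    then obtain r where "b * r \<in> M" "b * r \<noteq> 0"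
      using right_ideal_onD(2)[OF M] right_ideal_onD(2)[OF H] by blast
    thus "\<exists>r\<in>UNIV. b * r \<noteq> 0 \<and> a * (b * r) = 0" using aM by blast
  qed
qed

text \<open>Whenever \<open>y * b\<close> is nonzero, it has a nonzero common right multiple with
  \<open>x\<close> in \<open>U\<close>, which \<open>a\<close> kills. So the annihilator of
  \<open>a * y\<close> in the fixed ring is essential, and nonsingularity applies.\<close>

lemma uniform_torsion_free:
  assumes "prime_on (UNIV :: 'a set)" "goldie_on (UNIV :: 'a set)" "trace_nondegenerate G"
    and U: "uniform_on B U" and x: "x \<in> U" "x \<noteq> 0" "a * x = 0" and y: "y \<in> U"
  shows "a * y = 0"
proof (rule fixed_ring_nonsingular[OF assms(1-3)])
  fix b assume b: "b \<in> B" "b \<noteq> 0"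
  note S = unital_subringD[OF unital_subring_fixed]
  show "\<exists>r\<in>B. b * r \<noteq> 0 \<and> a * y * (b * r) = 0"
  proof (cases "y * b = 0")
    case True
    thus ?thesis using b S(1) by (intro bexI[of _ 1]) (auto simp: mult.assoc)
  next
    case False
    have "y * b \<in> U" using U y b right_ideal_onD(5) unfolding uniform_on_def by blast
    then obtain r s where rs: "r \<in> B" "s \<in> B" "y * b * r = x * s" "y * b * r \<noteq> 0"
      using U x False unfolding uniform_on_def by blast
    have "a * y * (b * r) = a * (y * b * r)" by (simp add: mult.assoc)
    also have "\<dots> = a * x * s" using rs(3) by (simp add: mult.assoc)
    also have "\<dots> = 0" using x(3) by simp
    finally show ?thesis using rs by (intro bexI[of _ r]) (auto simp: mult.assoc)
  qed
qed

end

section \<open>Uniform dimension of the twisted module \<open>A\<^sup>G\<close>\<close>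

lemma sum_lessThan_split:
  fixes F :: "nat \<Rightarrow> 'b::comm_monoid_add"
  assumes "a \<le> b"
  shows "(\<Sum>i<b. F i) = (\<Sum>i<a. F i) + (\<Sum>i\<in>{a..<b}. F i)"
  using sum.atLeastLessThan_concat[OF _ assms, of 0 F] by (simp add: lessThan_atLeast0)

context ring_aut_group
begin

text \<open>The \<open>m i\<close> generate independent submodules of \<open>A\<^sup>H\<close>, where \<open>A\<close> acts on the coordinate \<open>h\<close>
  through \<open>h\<close>.\<close>
definition indep_rows :: "('a \<Rightarrow> 'a) set \<Rightarrow> (nat \<Rightarrow> ('a \<Rightarrow> 'a) \<Rightarrow> 'a) \<Rightarrow> bool" where
  "indep_rows H m \<longleftrightarrow> (\<forall>i. \<exists>h\<in>H. m i h \<noteq> 0) \<and>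
     (\<forall>n r s. (\<forall>h\<in>H. m n h * h r = (\<Sum>i<n. m i h * h (s i))) \<longrightarrow> (\<forall>h\<in>H. m n h * h r = 0))"

lemma indep_rowsD:
  assumes "indep_rows H m" "\<And>h. h \<in> H \<Longrightarrow> m n h * h r = (\<Sum>i<n. m i h * h (s i))" "h \<in> H"
  shows "m n h * h r = 0"
proof -
  have "(\<forall>h\<in>H. m n h * h r = (\<Sum>i<n. m i h * h (s i))) \<longrightarrow> (\<forall>h\<in>H. m n h * h r = 0)"
    using assms(1) by (simp add: indep_rows_def)
  thus ?thesis using assms(2,3) by simp
qed

text \<open>The last term of the block is a combination of earlier rows and so vanishes by
  independence; descending through the block removes all of its terms.\<close>

lemma indep_rows_block:
  assumes H: "H \<subseteq> G" and m: "indep_rows H m"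
    and eq: "\<And>h. h \<in> H \<Longrightarrow> (\<Sum>i\<in>{a..<b}. m i h * h (p i)) = (\<Sum>i<a. m i h * h (q i))"
    and h: "h \<in> H"
  shows "(\<Sum>i\<in>{a..<b}. m i h * h (p i)) = 0"
  using eq h
proof (induction b arbitrary: h)
  case (Suc b)
  show ?case
  proof (cases "a \<le> b")
    case True
    let ?s = "\<lambda>i. if i < a then q i else - p i"
    have rel: "m b g * g (p b) = (\<Sum>i<b. m i g * g (?s i))" if g: "g \<in> H" for g
    proof -
      have gG: "g \<in> G" using g H by blast
      have "(\<Sum>i<b. m i g * g (?s i))
          = (\<Sum>i<a. m i g * g (?s i)) + (\<Sum>i\<in>{a..<b}. m i g * g (?s i))"
        by (rule sum_lessThan_split[OF True])
      also have "(\<Sum>i<a. m i g * g (?s i)) = (\<Sum>i<a. m i g * g (q i))"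
        by (intro sum.cong) auto
      also have "(\<Sum>i\<in>{a..<b}. m i g * g (?s i)) = (\<Sum>i\<in>{a..<b}. - (m i g * g (p i)))"
        by (intro sum.cong) (auto simp: minus_G[OF gG])
      finally have "(\<Sum>i<b. m i g * g (?s i))
          = (\<Sum>i<a. m i g * g (q i)) - (\<Sum>i\<in>{a..<b}. m i g * g (p i))"
        by (simp only: sum_negf add_uminus_conv_diff)
      moreover have "(\<Sum>i\<in>{a..<b}. m i g * g (p i)) + m b g * g (p b) = (\<Sum>i<a. m i g * g (q i))"
        using Suc.prems(1)[OF g] True by simp
      ultimately show ?thesis by (metis add_diff_cancel_left')
    qed
    have z: "m b g * g (p b) = 0" if "g \<in> H" for g
      by (rule indep_rowsD[where s = ?s, OF m _ that]) (rule rel)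
    have "(\<Sum>i\<in>{a..<b}. m i g * g (p i)) = (\<Sum>i<a. m i g * g (q i))" if "g \<in> H" for g
      using Suc.prems(1)[OF that] z[OF that] True by simp
    hence "(\<Sum>i\<in>{a..<b}. m i h * h (p i)) = 0" using Suc.IH Suc.prems(2) by blast
    thus ?thesis using z[OF Suc.prems(2)] True by simp
  qed simp
qed simp

text \<open>Finite uniform dimension passes through extensions: the coordinate \<open>h\<close> maps
  the module to a twisted copy of \<open>A\<close>, with kernel a module over fewer coordinates. An
  infinite independent family would survive either in the image or, after regrouping, in the
  kernel.\<close>

lemma goldie_no_indep_rows:
  assumes goldie: "goldie_on (UNIV :: 'a set)" and fin: "finite H" and H: "H \<subseteq> G"
  shows "\<not> indep_rows H m"
  using fin H
proof (induction H arbitrary: m)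
  case empty
  show ?case by (simp add: indep_rows_def)
next
  case (insert h H)
  show ?case
  proof
    assume m: "indep_rows (insert h H) m"
    have h: "h \<in> G" using insert.prems by simp
    have gG: "g \<in> G" if "g \<in> insert h H" for g using that insert.prems by blast
    define c where "c N K s g = (\<Sum>i\<in>{N..<K}. m i g * g (s i))" for N K s g
    show False
    proof (cases "\<exists>N. \<forall>K s. c N K s h = 0 \<longrightarrow> (\<forall>g\<in>insert h H. c N K s g = 0)")
      case True
      then obtain N where N: "\<And>K s g. c N K s h = 0 \<Longrightarrow> g \<in> insert h H \<Longrightarrow> c N K s g = 0" by blast
      text \<open>The projection to the coordinate \<open>h\<close> is injective on the tail.\<close>
      show False
      proof (rule goldie_no_independent_sequence[OF goldie unital_subring_UNIV, of "\<lambda>n. m (N + n) h"])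
        fix n
        show "m (N + n) h \<noteq> 0"
        proof
          assume z: "m (N + n) h = 0"
          have unit: "c N (Suc (N + n)) (\<lambda>i. if i = N + n then 1 else 0) g = m (N + n) g"
            if "g \<in> insert h H" for g
          proof -
            have "m i g * g (if i = N + n then 1 else 0) = (if i = N + n then m (N + n) g else 0)" for i
              using one_G[OF gG[OF that]] zero_G[OF gG[OF that]] by simp
            thus ?thesis by (simp add: c_def)
          qed
          have "m (N + n) g = 0" if "g \<in> insert h H" for g
            using N[of "Suc (N + n)" "\<lambda>i. if i = N + n then 1 else 0" g] unit[OF that] unit[of h] that z
            by simp
          thus False using m unfolding indep_rows_def by blast
        qed
        fix r s assume eq: "m (N + n) h * r = (\<Sum>i<n. m (N + i) h * s i)"
        \<comment> \<open>Coefficients act on the coordinate \<open>h\<close> through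
          \<open>h\<close>, so \<open>inv h\<close> converts a relation of right multiples in
          \<open>A\<close> into one among rows.\<close>
        let ?t = "\<lambda>i. if i < N + n then - inv h (s (i - N)) else inv h r"
        let ?s = "\<lambda>i. if N \<le> i then inv h (s (i - N)) else 0"
        have split: "c N (Suc (N + n)) ?t g
            = m (N + n) g * g (inv h r) - (\<Sum>i<n. m (N + i) g * g (inv h (s i)))"
          if "g \<in> insert h H" for g
        proof -
          have "c N (Suc (N + n)) ?t g
              = (\<Sum>i\<in>{N..<N + n}. m i g * g (?t i)) + m (N + n) g * g (inv h r)"
            by (simp add: c_def)
          also have "(\<Sum>i\<in>{N..<N + n}. m i g * g (?t i))
              = (\<Sum>i<n. m (N + i) g * g (?t (N + i)))"
            using sum.shift_bounds_nat_ivl[of "\<lambda>i. m i g * g (?t i)" 0 N n]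
            by (simp add: add.commute atLeast0LessThan)
          also have "\<dots> = (\<Sum>i<n. - (m (N + i) g * g (inv h (s i))))"
            by (intro sum.cong) (auto simp: minus_G[OF gG[OF that]])
          finally show ?thesis by (simp add: sum_negf)
        qed
        have "c N (Suc (N + n)) ?t h = 0"
          using split[of h] eq inv_apply_G(2)[OF h] by simp
        hence rel: "m (N + n) g * g (inv h r) = (\<Sum>i<n. m (N + i) g * g (inv h (s i)))"
          if "g \<in> insert h H" for g
          using N[of "Suc (N + n)" ?t g] split[OF that] that by simp
        have rel': "m (N + n) g * g (inv h r) = (\<Sum>i<N + n. m i g * g (?s i))"
          if g: "g \<in> insert h H" for g
        proof -
          have "(\<Sum>i<N + n. m i g * g (?s i))
              = (\<Sum>i<N. m i g * g (?s i)) + (\<Sum>i\<in>{N..<N + n}. m i g * g (?s i))"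
            by (rule sum_lessThan_split) simp
          also have "(\<Sum>i<N. m i g * g (?s i)) = 0"
            using zero_G[OF gG[OF g]] by (intro sum.neutral) auto
          also have "(\<Sum>i\<in>{N..<N + n}. m i g * g (?s i))
              = (\<Sum>i<n. m (N + i) g * g (?s (N + i)))"
            using sum.shift_bounds_nat_ivl[of "\<lambda>i. m i g * g (?s i)" 0 N n]
            by (simp add: add.commute atLeast0LessThan)
          finally show ?thesis using rel[OF g] by simp
        qed
        have "m (N + n) h * h (inv h r) = 0"
          by (rule indep_rowsD[where s = ?s, OF m]) (rule rel', simp_all)
        thus "m (N + n) h * r = 0" using inv_apply_G(2)[OF h] by simp
      qed simp
    next
      case False
      text \<open>Every tail meets the kernel of that projection: pass to disjoint blocks inside it.\<close>
      hence "\<forall>N. \<exists>K s. c N K s h = 0 \<and> (\<exists>g\<in>insert h H. c N K s g \<noteq> 0)" by blast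
      then obtain K s where Ks: "\<And>N. c N (K N) (s N) h = 0"
        "\<And>N. \<exists>g\<in>insert h H. c N (K N) (s N) g \<noteq> 0" by metis
      have KN: "N < K N" for N
      proof (rule ccontr)
        assume "\<not> N < K N"
        hence "c N (K N) (s N) g = 0" for g by (simp add: c_def)
        thus False using Ks(2)[of N] by simp
      qed
      \<comment> \<open>\<open>b j\<close> is the left end of the block number \<open>j\<close>;
        iterating \<open>K\<close> makes consecutive blocks adjacent.\<close>
      define b where "b = rec_nat (0::nat) (\<lambda>_. K)"
      have b: "b (Suc j) = K (b j)" for j by (simp add: b_def)
      define m' where "m' j g = c (b j) (b (Suc j)) (s (b j)) g" for j g
      have m'h: "m' j h = 0" for j unfolding m'_def b by (rule Ks(1))
      have m'_mult: "m' j g * g r = c (b j) (b (Suc j)) (\<lambda>i. s (b j) i * r) g"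
        if "g \<in> insert h H" for j g r
        by (simp add: m'_def c_def sum_distrib_right mult_G[OF gG[OF that]] mult.assoc)
      have "indep_rows H m'"
        unfolding indep_rows_def
      proof (intro conjI allI impI)
        show "\<exists>g\<in>H. m' j g \<noteq> 0" for j
          using Ks(2)[of "b j"] Ks(1)[of "b j"] unfolding m'_def b by auto
        fix n r t assume eqH: "\<forall>g\<in>H. m' n g * g r = (\<Sum>j<n. m' j g * g (t j))"
        hence eq: "m' n g * g r = (\<Sum>j<n. m' j g * g (t j))" if "g \<in> insert h H" for g
          using that m'h by auto
        have "\<exists>q. \<forall>g\<in>insert h H. (\<Sum>j<n. m' j g * g (t j)) = (\<Sum>i<b n. m i g * g (q i))"
        proof (induction n)
          case 0
          show ?case by (simp add: b_def)
        next
          case (Suc n)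
          then obtain q where q: "\<And>g. g \<in> insert h H \<Longrightarrow>
            (\<Sum>j<n. m' j g * g (t j)) = (\<Sum>i<b n. m i g * g (q i))" by blast
          let ?q = "\<lambda>i. if i < b n then q i else s (b n) i * t n"
          have step: "(\<Sum>j<Suc n. m' j g * g (t j)) = (\<Sum>i<b (Suc n). m i g * g (?q i))"
            if g: "g \<in> insert h H" for g
          proof -
            have "b n \<le> b (Suc n)" using KN[of "b n"] b by simp
            hence "(\<Sum>i<b (Suc n). m i g * g (?q i))
                = (\<Sum>i<b n. m i g * g (?q i)) + (\<Sum>i\<in>{b n..<b (Suc n)}. m i g * g (?q i))"
              by (rule sum_lessThan_split)
            also have "(\<Sum>i<b n. m i g * g (?q i)) = (\<Sum>i<b n. m i g * g (q i))"
              by (intro sum.cong) auto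
            also have "(\<Sum>i\<in>{b n..<b (Suc n)}. m i g * g (?q i)) = m' n g * g (t n)"
              unfolding m'_mult[OF g] c_def by (intro sum.cong) auto
            finally show ?thesis using q[OF g] by simp
          qed
          show ?case by (rule exI[of _ ?q]) (rule ballI, rule step)
        qed
        then obtain q where q: "\<And>g. g \<in> insert h H \<Longrightarrow>
          (\<Sum>j<n. m' j g * g (t j)) = (\<Sum>i<b n. m i g * g (q i))" by blast
        have blk: "(\<Sum>i\<in>{b n..<b (Suc n)}. m i g * g (s (b n) i * r)) = (\<Sum>i<b n. m i g * g (q i))"
          if "g \<in> insert h H" for g
          using eq[OF that] q[OF that] m'_mult[OF that, of n r] by (simp add: c_def)
        show "\<forall>g\<in>H. m' n g * g r = 0"
        proof
          fix g assume "g \<in> H"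
          hence g: "g \<in> insert h H" by simp
          have "(\<Sum>i\<in>{b n..<b (Suc n)}. m i g * g (s (b n) i * r)) = 0"
            by (rule indep_rows_block[OF insert.prems m blk g])
          thus "m' n g * g r = 0" unfolding m'_mult[OF g] c_def .
        qed
      qed
      thus False using insert.IH insert.prems by blast
    qed
  qed
qed

end

section \<open>Traces on domains\<close>

lemma domain_of_reduced_prime:
  assumes "prime_on (UNIV :: 'a::ring_1 set)" "no_nilpotents TYPE('a)" "a * b = (0 :: 'a)"
  shows "a = 0 \<or> b = 0"
proof -
  have red: "x = 0" if "x * x = 0" for x :: 'a
    using assms(2) that unfolding no_nilpotents_def by (metis power2_eq_square)
  have "(b * a) * (b * a) = b * (a * b) * a" by (simp only: mult.assoc)
  hence "(b * a) * (b * a) = 0" using assms(3) by simp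
  hence "b * a = 0" by (rule red)
  have "a * r * b = 0" for r
  proof (rule red)
    have "(a * r * b) * (a * r * b) = a * r * (b * a) * (r * b)" by (simp only: mult.assoc)
    thus "(a * r * b) * (a * r * b) = 0" using \<open>b * a = 0\<close> by simp
  qed
  thus ?thesis using assms(1) unfolding prime_on_def by blast
qed

text \<open>If \<open>a\<close> and \<open>b\<close> had no nonzero common right multiple, the
  elements \<open>a ^ n * b\<close> would be independent: in a relation the term
  \<open>b * s 0\<close> is a right multiple of \<open>a\<close>, hence zero, and one factor
  \<open>a\<close> cancels.\<close>

lemma goldie_domain_right_Ore:
  fixes a b :: "'a::ring_1"
  assumes goldie: "goldie_on (UNIV :: 'a set)"
    and dom: "\<And>a b :: 'a. a * b = 0 \<Longrightarrow> a = 0 \<or> b = 0" and ab: "a \<noteq> 0" "b \<noteq> 0"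
  shows "\<exists>r s. a * r = b * s \<and> a * r \<noteq> 0"
proof (rule ccontr)
  assume "\<not> ?thesis"
  hence no: "a * r = 0" if "a * r = b * s" for r s using that by blast
  show False
  proof (rule goldie_no_independent_sequence[OF goldie unital_subring_UNIV, of "\<lambda>n. a ^ n * b"])
    show "a ^ n * b \<noteq> 0" for n
    proof (induction n)
      case (Suc n)
      thus ?case using dom[of a "a ^ n * b"] ab(1) by (auto simp: mult.assoc)
    qed (use ab in simp)
    fix n r s assume "a ^ n * b * r = (\<Sum>i<n. a ^ i * b * s i)"
    thus "a ^ n * b * r = 0"
    proof (induction n arbitrary: s)
      case (Suc n)
      let ?y = "a ^ n * b * r - (\<Sum>i<n. a ^ i * b * s (Suc i))"
      have "(\<Sum>i<Suc n. a ^ i * b * s i) = b * s 0 + a * (\<Sum>i<n. a ^ i * b * s (Suc i))"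
        unfolding sum.lessThan_Suc_shift by (simp add: sum_distrib_left mult.assoc)
      hence "a * ?y = b * s 0"
        using Suc.prems by (simp add: right_diff_distrib mult.assoc)
      hence "a * ?y = 0" by (rule no)
      hence "?y = 0" using dom ab(1) by blast
      hence "a ^ n * b * r = 0" by (intro Suc.IH) simp
      thus ?case by (simp add: mult.assoc)
    qed simp
  qed simp
qed

lemma common_right_multiple:
  fixes v :: "'b \<Rightarrow> 'a::ring_1"
  assumes ore: "\<And>a b :: 'a. a \<noteq> 0 \<Longrightarrow> b \<noteq> 0 \<Longrightarrow> \<exists>r s. a * r = b * s \<and> a * r \<noteq> 0"
    and "(1 :: 'a) \<noteq> 0" "finite P" "\<And>p. p \<in> P \<Longrightarrow> v p \<noteq> 0"
  shows "\<exists>c. c \<noteq> 0 \<and> (\<forall>p\<in>P. \<exists>z. v p * z = c)"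
  using assms(3,4)
proof (induction P)
  case empty
  show ?case using assms(2) by blast
next
  case (insert q P)
  have "\<exists>c. c \<noteq> 0 \<and> (\<forall>p\<in>P. \<exists>z. v p * z = c)"
    by (rule insert.IH) (simp add: insert.prems)
  then obtain c where c: "c \<noteq> 0" "\<forall>p\<in>P. \<exists>z. v p * z = c" by (elim exE conjE)
  obtain r s where rs: "v q * r = c * s" "v q * r \<noteq> 0"
    using ore[OF insert.prems[OF insertI1] c(1)] by blast
  have "\<exists>z. v p * z = c * s" if p: "p \<in> insert q P" for p
  proof (cases "p = q")
    case True
    show ?thesis unfolding True using rs(1) by (rule exI)
  next
    case False
    hence "\<exists>z. v p * z = c" using c(2) p by simp
    then obtain z where "v p * z = c" ..
    hence "v p * (z * s) = c * s" by (simp add: mult.assoc[symmetric])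
    thus ?thesis by (rule exI)
  qed
  moreover have "c * s \<noteq> 0" using rs by simp
  ultimately show ?case by blast
qed

context ring_aut_group
begin

text \<open>Suppose \<open>tr (a A) = 0\<close>. Gaussian elimination over the right Ore domain \<open>A\<close> among the relations
  \<open>\<Sum>\<^sub>g g (a x) v\<^sub>g = 0\<close> decomposes a constant vector \<open>(c, \<dots>, c)\<close> into relations \<open>w\<^sub>p\<close> with pivots \<open>p\<close>.
  The relations are stable under left multiplication by \<open>(g y)\<^sub>g\<close>, so uniqueness of \<open>w\<^sub>p\<close> makes its entries
  intertwine these twists; this forces \<open>\<Sum>\<^sub>g w\<^sub>p(g) = 0\<close> for each \<open>p\<close>, hence \<open>|G| c = 0\<close>.\<close>
lemma trace_nondegenerate_of_domain:
  assumes dom: "\<And>a b :: 'a. a * b = 0 \<Longrightarrow> a = 0 \<or> b = 0"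
    and goldie: "goldie_on (UNIV :: 'a set)" and ne: "(1 :: 'a) \<noteq> 0"
  shows "trace_nondegenerate G"
  unfolding trace_nondegenerate_def
proof (intro allI impI)
  note ore = goldie_domain_right_Ore[OF goldie dom]
  fix a :: 'a assume a: "a \<noteq> 0"
  show "\<exists>b. tr (a * b) \<noteq> 0"
  proof (rule ccontr)
    assume "\<nexists>b. tr (a * b) \<noteq> 0"
    hence tr0: "tr (a * b) = 0" for b by blast
    define Rel where "Rel v \<longleftrightarrow> (\<forall>x. (\<Sum>g\<in>G. g (a * x) * v g) = 0)" for v :: "('a \<Rightarrow> 'a) \<Rightarrow> 'a"
    have Rel_const: "Rel (\<lambda>_. c)" for c
      using tr0 by (simp add: Rel_def trace_def flip: sum_distrib_right)
    have Rel_mult: "Rel (\<lambda>g. v g * z)" if "Rel v" for v z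
      using that by (simp add: Rel_def mult.assoc[symmetric] flip: sum_distrib_right)
    have Rel_diff: "Rel (\<lambda>g. v g - w g)" if "Rel v" "Rel w" for v w
      using that by (simp add: Rel_def right_diff_distrib sum_subtractf)
    have Rel_sum: "Rel (\<lambda>g. \<Sum>p\<in>P. w p g)" if "\<And>p. p \<in> P \<Longrightarrow> Rel (w p)" for P :: "('a \<Rightarrow> 'a) set" and w
    proof -
      have "(\<Sum>g\<in>G. g (a * x) * (\<Sum>p\<in>P. w p g)) = (\<Sum>p\<in>P. \<Sum>g\<in>G. g (a * x) * w p g)" for x
        unfolding sum_distrib_left by (rule sum.swap)
      thus ?thesis using that by (simp add: Rel_def)
    qed
    have Rel_twist: "Rel (\<lambda>g. g y * v g)" if "Rel v" for v y
    proof -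
      have "(\<Sum>g\<in>G. g (a * x) * (g y * v g)) = (\<Sum>g\<in>G. g (a * (x * y)) * v g)" for x
        by (intro sum.cong refl) (simp add: mult_G mult.assoc)
      thus ?thesis using that by (simp add: Rel_def)
    qed
    \<comment> \<open>\<open>free N\<close> says that relations are determined by their entries
      outside \<open>N\<close>. For maximal \<open>N\<close>, the complement \<open>P\<close> is a
      set of pivots: each \<open>p\<close> in \<open>P\<close> has a relation that is nonzero at
      \<open>p\<close> and zero at all other pivots.\<close>
    define free where "free N \<longleftrightarrow> (\<forall>v. Rel v \<longrightarrow> (\<forall>g\<in>G - N. v g = 0) \<longrightarrow> (\<forall>g\<in>G. v g = 0))" for N
    have "finite {N \<in> Pow G. free N}" using finite_G by simp
    moreover have "{} \<in> {N \<in> Pow G. free N}" by (simp add: free_def)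
    ultimately have "\<exists>N\<in>{N \<in> Pow G. free N}. {} \<subseteq> N \<and> (\<forall>M\<in>{N \<in> Pow G. free N}. N \<subseteq> M \<longrightarrow> N = M)"
      by (rule finite_has_maximal2)
    then obtain N where N: "N \<subseteq> G" "free N" and N_max: "\<And>M. M \<subseteq> G \<Longrightarrow> free M \<Longrightarrow> N \<subseteq> M \<Longrightarrow> N = M"
      by auto
    define P where "P = G - N"
    have freeD: "v g = 0" if "Rel v" "\<And>g. g \<in> P \<Longrightarrow> v g = 0" "g \<in> G" for v g
      using N(2) that unfolding free_def P_def by blast
    have "\<exists>v. Rel v \<and> (\<forall>g\<in>P - {p}. v g = 0) \<and> v p \<noteq> 0" if p: "p \<in> P" for p
    proof -
      have "\<not> free (insert p N)" using N_max[of "insert p N"] p N(1) by (auto simp: P_def)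
      then obtain v g where v: "Rel v" "\<And>h. h \<in> G - insert p N \<Longrightarrow> v h = 0" "g \<in> G" "v g \<noteq> 0"
        unfolding free_def by blast
      have "v p \<noteq> 0"
      proof
        assume "v p = 0"
        hence "v g = 0" using v(2) by (intro freeD[OF v(1) _ v(3)]) (auto simp: P_def)
        thus False using v(4) by blast
      qed
      thus ?thesis using v(1,2) by (intro exI[of _ v]) (auto simp: P_def)
    qed
    then obtain v where v: "\<And>p. p \<in> P \<Longrightarrow> Rel (v p)" "\<And>p g. p \<in> P \<Longrightarrow> g \<in> P \<Longrightarrow> g \<noteq> p \<Longrightarrow> v p g = 0"
      "\<And>p. p \<in> P \<Longrightarrow> v p p \<noteq> 0" by (metis Diff_iff singletonD)
    have finP: "finite P" using finite_G by (simp add: P_def)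
    \<comment> \<open>Pivots cannot be inverted, so they are normalised to a common right multiple
      \<open>c\<close> instead of 1.\<close>
    obtain c where c: "c \<noteq> 0" "\<And>p. p \<in> P \<Longrightarrow> \<exists>z. v p p * z = c"
      using common_right_multiple[OF ore ne finP, of "\<lambda>p. v p p"] v(3) by blast
    obtain z where z: "\<And>p. p \<in> P \<Longrightarrow> v p p * z p = c" using c(2) by metis
    define w where "w p g = v p g * z p" for p g
    have w: "Rel (w p)" "w p p = c" "\<And>g. g \<in> P \<Longrightarrow> g \<noteq> p \<Longrightarrow> w p g = 0" if "p \<in> P" for p
      using Rel_mult[OF v(1)[OF that]] z v(2) that by (auto simp: w_def[abs_def])
    have "c - (\<Sum>p\<in>P. w p g) = 0" if "g \<in> G" for g
    proof (rule freeD[OF _ _ that])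
      show "Rel (\<lambda>g. c - (\<Sum>p\<in>P. w p g))" by (intro Rel_diff Rel_const Rel_sum w(1))
      show "c - (\<Sum>p\<in>P. w p g) = 0" if g: "g \<in> P" for g
      proof -
        have "(\<Sum>p\<in>P. w p g) = (\<Sum>p\<in>P. if p = g then c else 0)"
          using w g by (intro sum.cong) auto
        thus ?thesis using finP g by simp
      qed
    qed
    hence "(\<Sum>g\<in>G. c) = (\<Sum>g\<in>G. \<Sum>p\<in>P. w p g)" by (intro sum.cong) auto
    also have "\<dots> = (\<Sum>p\<in>P. \<Sum>g\<in>G. w p g)" by (rule sum.swap)
    also have "\<dots> = 0"
    proof (rule sum.neutral, rule ballI)
      fix p assume p: "p \<in> P"
      have pG: "p \<in> G" using p by (simp add: P_def)
      have "p a \<noteq> 0" using a eq_0_G[OF pG] by simp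
      hence "p a * c \<noteq> 0" using dom c(1) by blast
      \<comment> \<open>Twisting by \<open>a\<close> multiplies the pivot entry of
        \<open>w p\<close> by \<open>p a\<close>; the Ore multipliers make it agree with that of
        \<open>w p\<close> times \<open>s\<close>. Equality then holds in all entries. Summed over
        \<open>G\<close>, the twisted side is the defining relation at \<open>x = 1\<close>, hence
        zero, and \<open>s\<close> cancels.\<close>
      then obtain r s where rs: "p a * c * r = c * s" "p a * c * r \<noteq> 0"
        using ore[of "p a * c" c] c(1) by blast
      have "g a * w p g * r - w p g * s = 0" if "g \<in> G" for g
      proof (rule freeD[OF _ _ that])
        show "Rel (\<lambda>g. g a * w p g * r - w p g * s)"
          by (intro Rel_diff Rel_mult Rel_twist w(1)[OF p])
        show "g a * w p g * r - w p g * s = 0" if "g \<in> P" for g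
          using that rs(1) w(2,3)[OF p] by (cases "g = p") auto
      qed
      hence "(\<Sum>g\<in>G. w p g * s) = (\<Sum>g\<in>G. g a * w p g * r)" by (intro sum.cong) auto
      hence "(\<Sum>g\<in>G. w p g) * s = (\<Sum>g\<in>G. g (a * 1) * w p g) * r"
        by (simp add: sum_distrib_right)
      also have "\<dots> = 0" using w(1)[OF p] unfolding Rel_def by (metis mult_zero_left)
      finally show "(\<Sum>g\<in>G. w p g) = 0" using dom rs by fastforce
    qed
    finally have "of_nat (card G) * c = 0" by simp
    moreover have "0 < card G" using finite_G id_G card_gt_0_iff by blast
    ultimately show False using torsion_free c(1) by blast
  qed
qed

end

section \<open>The rank of a prime Goldie ring over its fixed ring\<close>

text \<open>\<open>u0\<close> serves as a test element: by \<open>torsion_free_U\<close>, any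
  \<open>a\<close> with \<open>a * u0\<close> nonzero acts injectively on \<open>U\<close>.\<close>

locale goldie_galois = ring_aut_group +
  fixes U :: "'a set" and u0 :: 'a
  assumes primeA: "prime_on (UNIV :: 'a set)" and goldieA: "goldie_on (UNIV :: 'a set)"
    and nondeg: "trace_nondegenerate G"
    and primeB: "prime_on (fixed_ring G)" and goldieB: "goldie_on (fixed_ring G)"
    and uniform: "uniform_on (fixed_ring G) U" and u0: "u0 \<in> U" "u0 \<noteq> 0"
begin

lemmas fixed_closed = unital_subringD[OF unital_subring_fixed]

lemma ideal_U: "right_ideal_on B U"
  using uniform by (simp add: uniform_on_def)

lemmas ideal_closed = right_ideal_onD[OF ideal_U]

lemma torsion_free_U: "a * u0 \<noteq> 0 \<Longrightarrow> y \<in> U \<Longrightarrow> a * y = 0 \<Longrightarrow> y = 0"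
  using uniform_torsion_free[OF primeA goldieA nondeg uniform, of y a u0] u0(1) by blast

lemma prime_B: "a \<in> B \<Longrightarrow> b \<in> B \<Longrightarrow> a \<noteq> 0 \<Longrightarrow> b \<noteq> 0 \<Longrightarrow> \<exists>r\<in>B. a * r * b \<noteq> 0"
  using primeB unfolding prime_on_def by blast

text \<open>Independent \<open>x\<^sub>i U\<close> give independent submodules of \<open>A\<^sup>G\<close> generated by \<open>(x\<^sub>i g(u\<^sub>0))\<^sub>g\<close>, as is seen by
  multiplying a relation by \<open>g(w)\<close> and summing over \<open>g\<close>.\<close>
lemma no_infinite_left_indep: "\<exists>n. \<not> left_indep U x n"
proof (rule ccontr)
  assume "\<nexists>n. \<not> left_indep U x n"
  hence indep: "left_indep U x n" for n by blast
  have "indep_rows G (\<lambda>i g. x i * g u0)"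
    unfolding indep_rows_def
  proof (intro conjI allI impI)
    fix i
    have "x i * u0 \<noteq> 0"
    proof
      assume z: "x i * u0 = 0"
      have "(\<Sum>j<Suc i. x j * (if j = i then u0 else 0)) = x i * u0" by simp
      hence "(if i = i then u0 else 0) = 0"
        using left_indepD[OF indep[of "Suc i"], of "\<lambda>j. if j = i then u0 else 0" i] z u0(1) ideal_closed(2) by simp
      thus False using u0(2) by simp
    qed
    thus "\<exists>g\<in>G. x i * g u0 \<noteq> 0" using id_G by (intro bexI[of _ id]) auto
  next
    fix n r s
    assume eq: "\<forall>g\<in>G. x n * g u0 * g r = (\<Sum>i<n. x i * g u0 * g (s i))"
    have u0B: "u0 \<in> B" using ideal_closed(1) u0(1) .
    have tr_sum: "(\<Sum>g\<in>G. x i * g u0 * g y * g w) = x i * tr (u0 * (y * w))" for i y w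
      unfolding trace_def sum_distrib_left by (intro sum.cong refl) (simp add: mult_G mult.assoc)
    have "tr (u0 * (r * w)) = 0" for w
    proof -
      \<comment> \<open>Since \<open>u0\<close> is fixed, \<open>tr (u0 * y) = u0 * tr y\<close>
        lies in \<open>U\<close>. The factor \<open>u0\<close> in the rows thus makes these
        coefficients admissible for \<open>left_indep\<close>.\<close>
      let ?z = "\<lambda>i. if i = n then - tr (u0 * (r * w)) else tr (u0 * (s i * w))"
      have trU: "tr (u0 * y) \<in> U" for y
        unfolding trace_mult_left[OF u0B] by (rule ideal_closed(5)[OF u0(1) trace_fixed])
      have "x n * tr (u0 * (r * w)) = (\<Sum>g\<in>G. x n * g u0 * g r * g w)" by (simp add: tr_sum)
      also have "\<dots> = (\<Sum>g\<in>G. \<Sum>i<n. x i * g u0 * g (s i) * g w)"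
        using eq by (intro sum.cong refl) (simp add: sum_distrib_right)
      also have "\<dots> = (\<Sum>i<n. x i * tr (u0 * (s i * w)))"
        by (subst sum.swap) (simp add: tr_sum)
      finally have rel: "x n * tr (u0 * (r * w)) = (\<Sum>i<n. x i * tr (u0 * (s i * w)))" .
      have "(\<Sum>i<n. x i * ?z i) = (\<Sum>i<n. x i * tr (u0 * (s i * w)))"
        by (intro sum.cong) auto
      hence "(\<Sum>i<Suc n. x i * ?z i) = 0" using rel by simp
      hence "?z n = 0"
        using trU ideal_closed(4) by (intro left_indepD[OF indep[of "Suc n"], of ?z n]) auto
      thus ?thesis by simp
    qed
    hence "\<forall>w. tr (u0 * r * w) = 0" by (simp add: mult.assoc)
    hence z: "u0 * r = 0" using nondeg unfolding trace_nondegenerate_def by blast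
    show "\<forall>g\<in>G. x n * g u0 * g r = 0"
    proof
      fix g assume g: "g \<in> G"
      have "g u0 * g r = 0" using mult_G[OF g, of u0 r] z zero_G[OF g] by simp
      thus "x n * g u0 * g r = 0" by (simp add: mult.assoc)
    qed
  qed
  thus False using goldie_no_indep_rows[OF goldieA finite_G subset_refl] by blast
qed

text \<open>A family that cannot be prolonged by \<open>a\<close> has a relation whose coefficient
  \<open>u\<close> at \<open>a\<close> is nonzero. Finiteness comes from
  \<open>no_infinite_left_indep\<close>; \<open>l = 0\<close> is impossible, as \<open>a = 1\<close>
  would give \<open>u = 0\<close>.\<close>

lemma maximal_left_indep:
  "\<exists>l x. left_indep U x l \<and> 0 < l \<and>
     (\<forall>a. \<exists>u\<in>U. u \<noteq> 0 \<and> (\<exists>z. (\<forall>i<l. z i \<in> U) \<and> a * u = (\<Sum>i<l. x i * z i)))"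
proof -
  have "\<exists>l x. left_indep U x l \<and>
      (\<forall>a. \<exists>u\<in>U. u \<noteq> 0 \<and> (\<exists>z. (\<forall>i<l. z i \<in> U) \<and> a * u = (\<Sum>i<l. x i * z i)))"
  proof (rule ccontr)
    assume no: "\<not> ?thesis"
    have "\<exists>x. \<forall>n. left_indep U x n"
    proof (rule infinite_extension)
      show "left_indep U (\<lambda>_. 0) 0" by (simp add: left_indep_def)
      show "left_indep U y n" if xn: "left_indep U x n" and eq: "\<And>i. i < n \<Longrightarrow> x i = y i" for n x y
        unfolding left_indep_def
      proof (intro allI impI)
        fix z i assume z: "\<forall>i<n. z i \<in> U" "(\<Sum>i<n. y i * z i) = 0" "i < n"
        have "(\<Sum>i<n. x i * z i) = (\<Sum>i<n. y i * z i)" using eq by (intro sum.cong) auto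
        thus "z i = 0" using z left_indepD[OF xn, of z i] by simp
      qed
      fix n x assume xn: "left_indep U x n"
      then obtain a where a: "\<not> (\<exists>u\<in>U. u \<noteq> 0 \<and> (\<exists>z. (\<forall>i<n. z i \<in> U) \<and> a * u = (\<Sum>i<n. x i * z i)))"
        using no by blast
      have "left_indep U (x(n := a)) (Suc n)"
        unfolding left_indep_def
      proof (intro allI impI)
        fix z i assume z: "\<forall>i<Suc n. z i \<in> U" "(\<Sum>i<Suc n. (x(n := a)) i * z i) = 0" "i < Suc n"
        have "(\<Sum>i<n. (x(n := a)) i * z i) = (\<Sum>i<n. x i * z i)" by (intro sum.cong) auto
        hence eq: "(\<Sum>i<n. x i * z i) + a * z n = 0" using z(2) by simp
        hence "a * z n = (\<Sum>i<n. x i * - z i)"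
          by (simp add: sum_negf eq_neg_iff_add_eq_0 add.commute)
        moreover have "\<forall>i<n. - z i \<in> U" using z(1) ideal_closed(4) by simp
        moreover have znU: "z n \<in> U" using z(1) by simp
        ultimately have "z n = 0" using a by (metis (no_types))
        hence "(\<Sum>i<n. x i * z i) = 0" using eq by simp
        hence "i < n \<Longrightarrow> z i = 0" using left_indepD[OF xn, of z i] z(1) by simp
        thus "z i = 0" using \<open>z n = 0\<close> z(3) by (auto simp: less_Suc_eq)
      qed
      thus "\<exists>a. left_indep U (x(n := a)) (Suc n)" by (rule exI)
    qed
    thus False using no_infinite_left_indep by blast
  qed
  then obtain l x where lx: "left_indep U x l"
    "\<forall>a. \<exists>u\<in>U. u \<noteq> 0 \<and> (\<exists>z. (\<forall>i<l. z i \<in> U) \<and> a * u = (\<Sum>i<l. x i * z i))"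
    by (elim exE conjE)
  moreover have "0 < l"
  proof (rule ccontr)
    assume "\<not> 0 < l"
    hence "l = 0" by simp
    thus False using lx(2)[THEN spec, of 1] by simp
  qed
  ultimately show ?thesis by (intro exI conjI)
qed

text \<open>Uniformity of \<open>U\<close> acts as an Ore condition and merges the denominators of
  finitely many elements one at a time.\<close>

lemma common_denominator:
  assumes gen: "\<And>a. \<exists>u\<in>U. u \<noteq> 0 \<and> (\<exists>z. (\<forall>i<l. z i \<in> U) \<and> a * u = (\<Sum>i<l. x i * z i))"
    and fin: "finite P"
  shows "\<exists>s\<in>U. s * u0 \<noteq> 0 \<and> (\<forall>a\<in>P. \<exists>z. (\<forall>i<l. z i \<in> U) \<and> a * s = (\<Sum>i<(l::nat). x i * z i))"
proof -
  have ext: "\<exists>z. (\<forall>i<l. z i \<in> U) \<and> a * (u * t) = (\<Sum>i<l. x i * z i)"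
    if au: "\<exists>z. (\<forall>i<l. z i \<in> U) \<and> a * u = (\<Sum>i<l. x i * z i)" and t: "t \<in> B" for a u t
  proof -
    obtain z where z: "\<forall>i<l. z i \<in> U" "a * u = (\<Sum>i<l. x i * z i)" using au by blast
    have "a * (u * t) = (\<Sum>i<l. x i * (z i * t))"
      using z(2) by (simp add: mult.assoc[symmetric] sum_distrib_right)
    moreover have "\<forall>i<l. z i * t \<in> U" using z(1) ideal_closed(5) t by blast
    ultimately show ?thesis by (intro exI[of _ "\<lambda>i. z i * t"]) auto
  qed
  have "\<exists>u\<in>U. u \<noteq> 0 \<and> (\<forall>a\<in>P. \<exists>z. (\<forall>i<l. z i \<in> U) \<and> a * u = (\<Sum>i<l. x i * z i))"
    using fin
  proof (induction P)
    case empty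
    show ?case using u0 by blast
  next
    case (insert a P)
    obtain u where u: "u \<in> U" "u \<noteq> 0"
      "\<forall>a\<in>P. \<exists>z. (\<forall>i<l. z i \<in> U) \<and> a * u = (\<Sum>i<l. x i * z i)"
      using insert.IH by (elim bexE conjE)
    obtain u' where u': "u' \<in> U" "u' \<noteq> 0" "\<exists>z. (\<forall>i<l. z i \<in> U) \<and> a * u' = (\<Sum>i<l. x i * z i)"
      using gen[of a] by (elim bexE conjE)
    obtain r t where rt: "r \<in> B" "t \<in> B" "u * r = u' * t" "u * r \<noteq> 0"
      using uniform u(1,2) u'(1,2) unfolding uniform_on_def by blast
    show ?case
    proof (intro bexI[of _ "u * r"] conjI ballI)
      show "u * r \<in> U" using ideal_closed(5) u(1) rt(1) .
      show "u * r \<noteq> 0" by fact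
      fix b assume "b \<in> insert a P"
      thus "\<exists>z. (\<forall>i<l. z i \<in> U) \<and> b * (u * r) = (\<Sum>i<l. x i * z i)"
      proof
        assume "b = a"
        thus ?thesis unfolding rt(3) using ext[OF u'(3) rt(2)] by simp
      next
        assume "b \<in> P"
        thus ?thesis using ext[OF _ rt(1)] u(3) by simp
      qed
    qed
  qed
  then obtain u where u: "u \<in> U" "u \<noteq> 0"
    "\<forall>a\<in>P. \<exists>z. (\<forall>i<l. z i \<in> U) \<and> a * u = (\<Sum>i<l. x i * z i)"
    by (elim bexE conjE)
  \<comment> \<open>The merged denominator \<open>u\<close> may annihilate \<open>U\<close>.
    Primeness repairs this: \<open>u * t\<close> is nonzero on \<open>u0\<close>, hence injective on
    \<open>U\<close>.\<close>
  obtain t where t: "t \<in> B" "u * t * u0 \<noteq> 0" using prime_B[of u u0] ideal_closed(1) u u0 by blast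
  show ?thesis
  proof (intro bexI[of _ "u * t"] conjI ballI)
    show "u * t \<in> U" using ideal_closed(5) u(1) t(1) .
    show "u * t * u0 \<noteq> 0" by (rule t(2))
    show "\<exists>z. (\<forall>i<l. z i \<in> U) \<and> a * (u * t) = (\<Sum>i<l. x i * z i)" if "a \<in> P" for a
      using ext[OF _ t(1)] u(3) that by blast
  qed
qed

text \<open>Pairs of a slicing element of \<open>U\<close> and an element \<open>b_i\<close> putting
  the slice back in direct position. The matrix of products is triangular with diagonal injective on
  \<open>U\<close>, so relations among the \<open>b_i\<close> are solved by forward
  substitution.\<close>

definition slicing :: "nat \<Rightarrow> (nat \<Rightarrow> 'a \<times> 'a) \<Rightarrow> bool" where
  "slicing n f \<longleftrightarrow> (\<forall>i<n. fst (f i) \<in> U \<and> snd (f i) \<in> B \<and>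
     (\<forall>j<i. fst (f j) * snd (f i) = 0) \<and> fst (f i) * snd (f i) * u0 \<noteq> 0)"

lemma slicing_left_indep:
  assumes "slicing n f" shows "left_indep U (\<lambda>i. snd (f i)) n"
  unfolding left_indep_def
proof (intro allI impI)
  fix z k assume z: "\<forall>i<n. z i \<in> U" "(\<Sum>i<n. snd (f i) * z i) = 0" and "k < n"
  from \<open>k < n\<close> show "z k = 0"
  proof (induction k rule: less_induct)
    case (less k)
    have "fst (f k) * (snd (f i) * z i) = (if i = k then fst (f k) * snd (f k) * z k else 0)"
      if "i < n" for i
    proof (cases i k rule: linorder_cases)
      case greater
      hence "fst (f k) * snd (f i) = 0" using assms that unfolding slicing_def by blast
      thus ?thesis using greater by (simp flip: mult.assoc)
    qed (use less.IH that in \<open>auto simp: mult.assoc\<close>)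
    hence "(\<Sum>i<n. fst (f k) * (snd (f i) * z i))
        = (\<Sum>i<n. if i = k then fst (f k) * snd (f k) * z k else 0)"
      by (intro sum.cong) auto
    also have "\<dots> = fst (f k) * snd (f k) * z k" using less.prems by simp
    finally have "fst (f k) * snd (f k) * z k = 0"
      using z(2) by (simp flip: sum_distrib_left)
    moreover have "fst (f k) * snd (f k) * u0 \<noteq> 0"
      using assms less.prems unfolding slicing_def by blast
    ultimately show ?case using torsion_free_U z(1) less.prems by blast
  qed
qed

text \<open>As long as some nonzero \<open>w\<close> is killed by all slicing elements, primeness
  used on both sides of \<open>w\<close> supplies a further pair \<open>(u0 * s, w * t)\<close>. An
  endless process would make the \<open>b n * u0\<close> independent, against the Goldie condition
  on the fixed ring.\<close>

lemma slicing_exists: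
  "\<exists>n f. slicing n f \<and> (\<forall>w\<in>B. (\<forall>i<n. fst (f i) * w = 0) \<longrightarrow> w = 0)"
proof (rule ccontr)
  assume no: "\<not> ?thesis"
  have "\<exists>f. \<forall>n. slicing n f"
  proof (rule infinite_extension)
    show "slicing 0 (\<lambda>_. (0, 0))" by (simp add: slicing_def)
    show "slicing n g" if "slicing n f" "\<And>i. i < n \<Longrightarrow> f i = g i" for n f g
      using that by (simp add: slicing_def)
    fix n f assume f: "slicing n f"
    then obtain w where w: "w \<in> B" "\<forall>i<n. fst (f i) * w = 0" "w \<noteq> 0" using no by blast
    obtain s where s: "s \<in> B" "u0 * s * w \<noteq> 0" using prime_B[of u0 w] ideal_closed(1) u0 w by blast
    have u0s: "u0 * s \<in> U" using ideal_closed(5) u0(1) s(1) .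
    have "u0 * s * w \<in> B" using fixed_closed(4) ideal_closed(1) u0s w(1) by blast
    then obtain t where t: "t \<in> B" "u0 * s * w * t * u0 \<noteq> 0"
      using prime_B[of "u0 * s * w" u0] s(2) ideal_closed(1) u0 by blast
    have "slicing (Suc n) (f(n := (u0 * s, w * t)))"
      unfolding slicing_def
    proof (intro allI impI)
      fix i assume "i < Suc n"
      show "fst ((f(n := (u0 * s, w * t))) i) \<in> U \<and> snd ((f(n := (u0 * s, w * t))) i) \<in> B \<and>
        (\<forall>j<i. fst ((f(n := (u0 * s, w * t))) j) * snd ((f(n := (u0 * s, w * t))) i) = 0) \<and>
        fst ((f(n := (u0 * s, w * t))) i) * snd ((f(n := (u0 * s, w * t))) i) * u0 \<noteq> 0"
      proof (cases "i = n")
        case True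
        have "fst (f j) * (w * t) = 0" if "j < n" for j
          using w(2) that by (simp flip: mult.assoc)
        thus ?thesis using True u0s fixed_closed(4)[OF w(1) t(1)] t(2) by (simp add: mult.assoc)
      next
        case False
        hence "i < n" using \<open>i < Suc n\<close> by simp
        thus ?thesis using f by (simp add: slicing_def)
      qed
    qed
    thus "\<exists>p. slicing (Suc n) (f(n := p))" by (rule exI)
  qed
  then obtain f where f: "\<And>n. slicing n f" by blast
  define b where "b i = snd (f i)" for i
  have indep: "left_indep U b n" for n
    unfolding b_def using slicing_left_indep[OF f] .
  have fn: "b n \<in> B" "fst (f n) * b n * u0 \<noteq> 0" for n
    using f[of "Suc n"] by (auto simp: slicing_def b_def)
  show False
  proof (rule goldie_no_independent_sequence[OF goldieB unital_subring_fixed, of "\<lambda>n. b n * u0"])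
    show "b n * u0 \<in> B" for n using fixed_closed(4) fn(1) ideal_closed(1) u0(1) by blast
    show "b n * u0 \<noteq> 0" for n using fn(2)[of n] by (auto simp: mult.assoc)
    fix n r s assume rs: "r \<in> B" "\<And>i. s i \<in> B" "b n * u0 * r = (\<Sum>i<n. b i * u0 * s i)"
    let ?z = "\<lambda>i. if i = n then - (u0 * r) else u0 * s i"
    have "(\<Sum>i<n. b i * ?z i) = (\<Sum>i<n. b i * u0 * s i)"
      by (intro sum.cong) (auto simp: mult.assoc)
    hence "(\<Sum>i<Suc n. b i * ?z i) = 0" using rs(3) by (simp add: mult.assoc)
    moreover have "?z i \<in> U" for i using ideal_closed(4,5) u0(1) rs(1,2) by simp
    ultimately have "?z n = 0" using left_indepD[OF indep[of "Suc n"], of ?z n] by blast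
    thus "b n * u0 * r = 0" by (simp add: mult.assoc)
  qed
qed

end

section \<open>The two inequalities between the lower transcendence degrees\<close>

context k_algebra
begin

lemma of_nat_mult_eq_0:
  assumes "0 < n" "of_nat n * (a :: 'a) = 0" shows "a = 0"
proof -
  have "scale (of_nat n) a = of_nat n * a"
    by (induction n) (simp_all add: scale_left_distrib distrib_right)
  thus ?thesis using assms by simp
qed

lemma ring_aut_group_of_finite_aut_group:
  assumes "finite_aut_group scale G" shows "ring_aut_group G"
proof
  fix n and a :: 'a assume "0 < n" "of_nat n * a = 0" thus "a = 0" by (rule of_nat_mult_eq_0)
qed (use assms in \<open>auto simp: finite_aut_group_def kalg_aut_def\<close>)

lemma scale_eq_mult_one: "scale k a = a * scale k 1"
  using scale_mult_right[of k a 1] by simp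

lemma subspace_right_ideal:
  assumes "right_ideal_on S I" "\<And>k. scale k 1 \<in> S"
  shows "subspace I"
  unfolding subspace_def
proof (intro conjI ballI allI)
  show "0 \<in> I" by (rule right_ideal_onD(2)[OF assms(1)])
  show "x + y \<in> I" if "x \<in> I" "y \<in> I" for x y using right_ideal_onD(3)[OF assms(1) that] .
  show "scale c x \<in> I" if "x \<in> I" for c x
    using right_ideal_onD(5)[OF assms(1) that assms(2)] unfolding scale_eq_mult_one[of c x] .
qed

lemma LD_fixed_ring_le:
  assumes grp: "finite_aut_group scale G" and nondeg: "trace_nondegenerate G"
  shows "LD scale (fixed_ring G) \<le> LD scale UNIV"
proof (rule LD_le)
  interpret ring_aut_group G by (rule ring_aut_group_of_finite_aut_group[OF grp])
  fix V d c assume V: "subframe scale (fixed_ring G) V" and d: "0 < d" "0 < c" "vdi d c (fixed_ring G) V"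
  have VV: "fin_dim V" "V \<subseteq> fixed_ring G" "1 \<in> V" using V by (auto simp: subframe_def fd_subspace_iff)
  have scale_G: "g (scale k a) = scale k (g a)" if "g \<in> G" for g k a
    using grp that by (simp add: finite_aut_group_def kalg_aut_def)
  have "vdi d c UNIV V"
  proof (rule vdi_of_torsionless[OF d(3,1,2) VV(1)])
    fix a :: 'a assume "a \<noteq> 0"
    then obtain x where x: "tr (a * x) \<noteq> 0" using nondeg unfolding trace_nondegenerate_def by blast
    show "\<exists>f. Vector_Spaces.linear scale scale f \<and> range f \<subseteq> fixed_ring G \<and>
        (\<forall>v\<in>V. \<forall>y. f (v * y) = v * f y) \<and> f a \<noteq> 0"
    proof (intro exI[of _ "\<lambda>y. tr (y * x)"] conjI ballI allI)
      show "Vector_Spaces.linear scale scale (\<lambda>y. tr (y * x))"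
      proof unfold_locales
        show "tr ((y + z) * x) = tr (y * x) + tr (z * x)" for y z
          by (simp add: distrib_right trace_add)
        show "tr (scale k y * x) = scale k (tr (y * x))" for k y
          unfolding trace_def scale_sum_right scale_mult_left[symmetric]
          by (intro sum.cong refl scale_G)
      qed
      show "range (\<lambda>y. tr (y * x)) \<subseteq> fixed_ring G" using trace_fixed by blast
      show "tr (v * y * x) = v * tr (y * x)" if "v \<in> V" for v y
        using trace_mult_left[of v "y * x"] that VV(2) by (auto simp: mult.assoc)
    qed (rule x)
  qed
  moreover have "subframe scale UNIV V" using VV by (simp add: subframe_def fd_subspace_iff)
  ultimately show "\<exists>V' c'. subframe scale UNIV V' \<and> 0 < c' \<and> vdi d c' UNIV V'" using d(2) by blast
qed

lemma subspace_fixed_ring: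
  assumes grp: "finite_aut_group scale G"
  shows "subspace (fixed_ring G)" "scale k 1 \<in> fixed_ring G"
proof -
  interpret ring_aut_group G by (rule ring_aut_group_of_finite_aut_group[OF grp])
  show one: "scale k 1 \<in> fixed_ring G" for k
    using grp by (auto simp: fixed_ring_def finite_aut_group_def kalg_aut_def)
  have "right_ideal_on (fixed_ring G) (fixed_ring G)"
    using unital_subringD[OF unital_subring_fixed] by (simp add: right_ideal_on_def)
  thus "subspace (fixed_ring G)" using one by (rule subspace_right_ideal)
qed

lemma LD_le_LD_fixed_ring:
  assumes grp: "finite_aut_group scale G" and nondeg: "trace_nondegenerate G"
    and primeA: "prime_on (UNIV :: 'a set)" and goldieA: "goldie_on (UNIV :: 'a set)"
    and primeB: "prime_on (fixed_ring G)" and goldieB: "goldie_on (fixed_ring G)"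
  shows "LD scale UNIV \<le> LD scale (fixed_ring G)"
proof (rule LD_le)
  interpret R: ring_aut_group G by (rule ring_aut_group_of_finite_aut_group[OF grp])
  have ne: "(1 :: 'a) \<noteq> 0" using primeA by (simp add: prime_on_def)
  obtain U :: "'a set" where uniform: "uniform_on (fixed_ring G) U"
    using goldie_uniform_exists[OF goldieB R.unital_subring_fixed ne] by blast
  obtain u0 where u0: "u0 \<in> U" "u0 \<noteq> 0"
    using uniform right_ideal_onD(2) unfolding uniform_on_def by blast
  interpret goldie_galois G U u0 by unfold_locales fact+
  have U_sub: "subspace U" using ideal_U subspace_fixed_ring(2)[OF grp] by (rule subspace_right_ideal)
  fix V d c assume V: "subframe scale UNIV V" and d: "0 < d" "0 < c" "vdi d c UNIV V"
  have VV: "fin_dim V" "1 \<in> V" using V by (auto simp: subframe_def fd_subspace_iff)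
  then obtain F where F: "finite F" "span F = V" by (auto simp: fin_dim_def)
  obtain l x where lx: "left_indep U x l" "0 < l"
    "\<forall>a. \<exists>u\<in>U. u \<noteq> 0 \<and> (\<exists>z. (\<forall>i<l. z i \<in> U) \<and> a * u = (\<Sum>i<l. x i * z i))"
    using maximal_left_indep by (elim exE conjE)
  have "finite ((\<lambda>(v, j). v * x j) ` (F \<times> {..<l}))" using F(1) by simp
  from common_denominator[OF lx(3)[rule_format] this]
  obtain s where s: "s \<in> U" "s * u0 \<noteq> 0"
    "\<forall>a\<in>(\<lambda>(v, j). v * x j) ` (F \<times> {..<l}). \<exists>z. (\<forall>i<l. z i \<in> U) \<and> a * s = (\<Sum>i<l. x i * z i)"
    by (elim bexE conjE)
  have "\<forall>v j. \<exists>z. v \<in> F \<and> j < l \<longrightarrow> (\<forall>i<l. z i \<in> U) \<and> v * x j * s = (\<Sum>i<l. x i * z i)"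
    using s(3) by force
  then obtain k where k': "\<forall>v j. v \<in> F \<and> j < l \<longrightarrow>
      (\<forall>i<l. k v j i \<in> U) \<and> v * x j * s = (\<Sum>i<l. x i * k v j i)"
    unfolding choice_iff by (elim exE)
  have k: "\<And>v j i. v \<in> F \<Longrightarrow> j < l \<Longrightarrow> i < l \<Longrightarrow> k v j i \<in> U"
    "\<And>v j. v \<in> F \<Longrightarrow> j < l \<Longrightarrow> v * x j * s = (\<Sum>i<l. x i * k v j i)"
    using k' by simp_all
  \<comment> \<open>The matrix entries of the generators \<open>F\<close> of \<open>V\<close>,
    acting on the sum of the \<open>x_i U\<close> after multiplication by the denominator
    \<open>s\<close>.\<close>
  define K where "K = (\<lambda>(v, j, i). k v j i) ` (F \<times> {..<l} \<times> {..<l})"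
  have K: "finite K" "K \<subseteq> U" using F(1) k(1) by (auto simp: K_def)
  have KU: "t * u \<in> U" if "t \<in> K" "u \<in> U" for t u
    using ideal_closed(5)[of t u] ideal_closed(1)[OF that(2)] K(2) that(1) by blast
  have mat: "v * (x j * s) \<in> span (\<Union>i<l. (*) (x i) ` span K)" if v: "v \<in> V" and j: "j < l" for v j
  proof (rule mult_mem_span)
    show "v \<in> span F" using v F(2) by simp
    show "x j * s \<in> span {x j * s}" by (simp add: span_base)
    fix f h assume f: "f \<in> F" and "h \<in> {x j * s}"
    hence "f * h = (\<Sum>i<l. x i * k f j i)" using k(2)[OF f j] by (simp add: mult.assoc)
    also have "\<dots> \<in> span (\<Union>i<l. (*) (x i) ` span K)"
    proof (rule span_sum)
      fix i assume "i \<in> {..<l}"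
      moreover have "k f j i \<in> K" unfolding K_def using f j calculation by force
      ultimately show "x i * k f j i \<in> span (\<Union>i<l. (*) (x i) ` span K)"
        by (intro span_base) (auto intro: span_base)
    qed
    finally show "f * h \<in> span (\<Union>i<l. (*) (x i) ` span K)" .
  qed simp
  \<comment> \<open>\<open>c1\<close> is the constant left after dividing by the \<open>l\<close>
    summands; the cap at 1 is what monotonicity of \<open>growth\<close> asks for when a subspace is
    sliced.\<close>
  define c1 where "c1 = c * real l powr ((d - 1) / d - 1)"
  define c' where "c' = min c1 1"
  have c': "0 < c'" "c' \<le> 1" "c' \<le> c1" using d(2) lx(2) by (auto simp: c'_def c1_def)
  have gr: "growth d c' (dim W) \<le> real (dim (mult_space scale (span K) W))"
    if W: "fin_dim W" "W \<subseteq> U" for W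
  proof -
    have "growth d c1 (dim W) \<le> real (dim (mult_space scale (span K) W))"
      unfolding c1_def
    proof (rule growth_in_right_ideal[OF d(3,1,2) VV(1) U_sub lx(2,1) _ _ K(1) KU mat W])
      show "s * u \<in> U" if "u \<in> U" for u using ideal_closed(5)[OF s(1) ideal_closed(1)[OF that]] .
      show "u = 0" if "u \<in> U" "s * u = 0" for u using torsion_free_U[OF s(2) that] .
    qed
    thus ?thesis using growth_mono_const[OF c'(3), of d "dim W"] by linarith
  qed
  obtain n f where f: "slicing n f" "\<forall>w\<in>fixed_ring G. (\<forall>i<n. fst (f i) * w = 0) \<longrightarrow> w = 0"
    using slicing_exists by (elim exE conjE)
  let ?V = "span (insert 1 {snd (f i) * t * fst (f i) | i t. i < n \<and> t \<in> K})"
  have "vdi d c' (fixed_ring G) ?V"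
  proof (rule vdi_of_slices[OF gr d(1) c'(1,2) U_sub K(1) KU slicing_left_indep[OF f(1)]])
    show "fst (f i) * w \<in> U" if "i < n" "w \<in> fixed_ring G" for i w
      using f(1) ideal_closed(5) that unfolding slicing_def by blast
    show "w = 0" if "w \<in> fixed_ring G" "\<forall>i<n. fst (f i) * w = 0" for w
      using f(2) that by blast
  qed
  moreover have "subframe scale (fixed_ring G) ?V"
  proof -
    have "{snd (f i) * t * fst (f i) | i t. i < n \<and> t \<in> K}
        = (\<lambda>(i, t). snd (f i) * t * fst (f i)) ` ({..<n} \<times> K)" by auto
    hence fin: "finite (insert 1 {snd (f i) * t * fst (f i) | i t. i < n \<and> t \<in> K})"
      using K(1) by simp
    have "snd (f i) * t * fst (f i) \<in> fixed_ring G" if "i < n" "t \<in> K" for i t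
    proof -
      have "fst (f i) \<in> U" "snd (f i) \<in> fixed_ring G" using f(1) that(1) by (auto simp: slicing_def)
      thus ?thesis using fixed_closed(4) ideal_closed(1) K(2) that(2) by (meson subsetD)
    qed
    hence "?V \<subseteq> fixed_ring G"
      using fixed_closed(1) by (intro span_minimal subspace_fixed_ring(1)[OF grp]) auto
    thus ?thesis using fin_dim_span[OF fin] by (simp add: subframe_def fd_subspace_iff span_base)
  qed
  ultimately show "\<exists>V' c'. subframe scale (fixed_ring G) V' \<and> 0 < c' \<and> vdi d c' (fixed_ring G) V'"
    using c'(1) by blast
qed

end

theorem theorem4p4:
  fixes scale :: "'k::field_char_0 \<Rightarrow> 'a::ring_1 \<Rightarrow> 'a"
    and G :: "('a \<Rightarrow> 'a) set"
  assumes alg: "kalgebra scale"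
    and primeA: "prime_on (UNIV :: 'a set)"
    and goldieA: "goldie_on (UNIV :: 'a set)"
    and grp: "finite_aut_group scale G"
    and tr_or_red: "trace_nondegenerate G \<or> no_nilpotents TYPE('a)"
    and primeB: "prime_on (fixed_ring G)"
    and goldieB: "goldie_on (fixed_ring G)"
  shows "LD scale (UNIV :: 'a set) = LD scale (fixed_ring G)
         \<and> (LD_stable scale (UNIV :: 'a set) \<longrightarrow> LD_stable scale (fixed_ring G))"
proof -
  interpret k_algebra scale using alg by (simp add: kalgebra_iff)
  interpret ring_aut_group G by (rule ring_aut_group_of_finite_aut_group[OF grp])
  have ne: "(1 :: 'a) \<noteq> 0" using primeA by (simp add: prime_on_def)
  have nondeg: "trace_nondegenerate G"
    using tr_or_red
  proof
    assume "no_nilpotents TYPE('a)"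
    thus ?thesis
      using trace_nondegenerate_of_domain[OF domain_of_reduced_prime[OF primeA] goldieA ne] by blast
  qed
  have eq: "LD scale UNIV = LD scale (fixed_ring G)"
    using LD_fixed_ring_le[OF grp nondeg]
      LD_le_LD_fixed_ring[OF grp nondeg primeA goldieA primeB goldieB] by (rule antisym[rotated])
  moreover have "LD_stable scale (fixed_ring G)" if "LD_stable scale UNIV"
    using LD_stable_subalgebra[OF subspace_fixed_ring(1)[OF grp] _ _ ne eq that]
      unital_subringD[OF unital_subring_fixed] by blast
  ultimately show ?thesis by blast
qed

end
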